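(* Let $\varepsilon>0$ be sufficiently small, let $g$ be a natural number that is sufficiently large depending on $\varepsilon$, let $b\in\{2,3,\dots,g-1\}$ be fixed, and let $X$ be a (large) power of $g$. Let $H$ satisfy $X^{3/5+\varepsilon}\ll H\ll X^{1-\varepsilon}$. Then $$\sum_{n\in[X,X+H]^{\ast}} d_4(n)\ \ll\ (\log X)^{7}\,\bigl|[X,X+H]^{\ast}\bigr|.$$
   Context: $d_4(n)$ is the number of ordered ways of writing $n=n_1n_2n_3n_4$ with $n_i\in\mathbb N$. For the fixed base $g$ and fixed digit $b$, $[X,X+H]^{\ast}$ denotes the set of natural numbers $n$ with $X<n\le X+H$ whose base-$g$ expansion uses only digits from $\{0,1,\dots,g-1\}\setminus\{b\}$. *)

theory Defs
  imports Complex_Main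
begin

text \<open>The number of ordered factorizations of \<open>n\<close> into four positive factors.\<close>

definition d4 :: "nat \<Rightarrow> nat" where
  "d4 n = card {(n1, n2, n3, n4).
     n1 > 0 \<and> n2 > 0 \<and> n3 > 0 \<and> n4 > 0 \<and> n = n1 * n2 * n3 * n4}"

text \<open>For \<open>g \<ge> 2\<close> and \<open>n \<ge> 1\<close> the positions \<open>i\<close> with \<open>g ^ i \<le> n\<close> are exactly those occurring
  in the base-\<open>g\<close> expansion of \<open>n\<close> without leading zeros.\<close>

definition base_digits :: "nat \<Rightarrow> nat \<Rightarrow> nat set" where
  "base_digits g n = {(n div g ^ i) mod g | i. g ^ i \<le> n}"

text \<open>The set \<open>[X, X+H]\<^sup>*\<close>; the base \<open>g\<close> and the excluded digit \<open>b\<close> are made explicit. The left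
  endpoint is excluded despite the closed bracket.\<close>

definition missing_digit_interval :: "nat \<Rightarrow> nat \<Rightarrow> real \<Rightarrow> real \<Rightarrow> nat set" where
  "missing_digit_interval g b X H =
     {n. X < real n \<and> real n \<le> X + H \<and> base_digits g n \<subseteq> {0..<g} - {b}}"

end

theory Submission
  imports Defs "HOL-Computational_Algebra.Computational_Algebra" "HOL-Real_Asymp.Real_Asymp"
begin

text \<open>Since \<open>X = g ^ k\<close> and \<open>b \<ge> 2\<close>, the set in question is, up to constants depending on \<open>g\<close>,
  \<open>X + A\<close> with \<open>A\<close> the integers below \<open>g ^ J \<approx> H\<close> without the digit \<open>b\<close>. For \<open>n \<le> 2 X\<close> without a
  square divisor \<open>t\<^sup>2\<close>, \<open>t > X ^ (1/100)\<close>, the value \<open>d\<^sub>4 n\<close> is at most a constant times the sum of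
  \<open>d\<^sub>7 D\<close> over the divisors \<open>D\<close> of \<open>n\<close> with \<open>D\<^sup>2 \<le> 2 X ^ (21/20)\<close>; the exceptional \<open>n\<close> are counted
  trivially. By additive characters, the number of multiples of \<open>D\<close> in \<open>X + A\<close> is at most \<open>card A / D\<close>
  times the sum of the normalized Fourier transform of \<open>A\<close> over all \<open>a / D\<close>. The \<open>L\<^sup>1\<close> norm of that
  transform grows only like a power of \<open>log g\<close> per digit, so for large \<open>g\<close> the sum over reduced
  fractions \<open>a / q\<close>, weighted by \<open>d\<^sub>7 q / q\<close>, stays bounded as long as \<open>D\<close> is a bit smaller than
  \<open>g ^ J\<close>. What remains is the sum of \<open>d\<^sub>7 e / e\<close>, which is \<open>O(log\<^sup>7 X)\<close>.\<close>

section \<open>Divisor functions\<close>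

text \<open>For \<open>k > 0\<close> the sum at \<open>n = 0\<close> ranges over an infinite set, so \<open>dk k 0 = 0\<close>.\<close>

primrec dk :: "nat \<Rightarrow> nat \<Rightarrow> nat" where
  "dk 0 n = (if n = 1 then 1 else 0)"
| "dk (Suc k) n = (\<Sum>d | d dvd n. dk k d)"

lemma finite_nat_divisors [simp]: "n > 0 \<Longrightarrow> finite {d. d dvd (n::nat)}"
  using finite_divisors_nat by blast

lemma dk_one [simp]: "dk k (Suc 0) = 1"
  by (induction k) auto

lemma dk_1: "n > 0 \<Longrightarrow> dk 1 n = 1"
  by (simp add: sum.delta)

text \<open>A factorization is encoded by the divisor chain \<open>n1 * n2 * n3\<close>,
  \<open>n1 * n2\<close>, \<open>n1\<close> below \<open>n\<close>; the factors are recovered as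
  successive quotients. \<open>dk 4 n\<close> counts such chains, the innermost \<open>dk 1\<close>
  being 1.\<close>

lemma d4_le_dk:
  assumes "n > 0"
  shows "d4 n \<le> dk 4 n"
proof -
  let ?S = "{(n1, n2, n3, n4). n1 > 0 \<and> n2 > 0 \<and> n3 > 0 \<and> n4 > 0 \<and> n = n1 * n2 * n3 * n4}"
  let ?T = "SIGMA d1:{d. d dvd n}. SIGMA d2:{d. d dvd d1}. {d. d dvd d2}"
  have fin: "finite {e. e dvd d}" if "d dvd n" for d
    using that assms by (metis dvd_pos_nat finite_nat_divisors)
  have fin2: "finite {e. e dvd d'}" if "d dvd n" "d' dvd d" for d d'
    using that fin dvd_trans by blast
  have finT: "finite ?T"
    using fin fin2 assms by (intro finite_SigmaI) auto
  have "card ?S \<le> card ?T"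
  proof (rule card_inj_on_le[where f = "\<lambda>(n1, n2, n3, n4). (n1 * n2 * n3, n1 * n2, n1)"])
    show "inj_on (\<lambda>(n1, n2, n3, n4). (n1 * n2 * n3, n1 * n2, n1)) ?S"
      by (auto simp: inj_on_def)
  qed (use finT in auto)
  also have "\<dots> = (\<Sum>d1 | d1 dvd n. \<Sum>d2 | d2 dvd d1. card {d. d dvd d2})"
    using fin fin2 assms by (subst card_SigmaI; (intro ballI finite_SigmaI sum.cong refl card_SigmaI)?) auto
  also have "\<dots> = (\<Sum>d1 | d1 dvd n. \<Sum>d2 | d2 dvd d1. \<Sum>d | d dvd d2. dk 1 d)"
  proof (intro sum.cong refl)
    fix d1 d2 assume "d1 \<in> {d. d dvd n}" "d2 \<in> {d. d dvd d1}"
    hence pos: "d2 > 0" using assms by (auto intro: dvd_pos_nat)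
    have "(\<Sum>d | d dvd d2. dk 1 d) = (\<Sum>d | d dvd d2. 1)"
      by (intro sum.cong refl dk_1) (use pos dvd_pos_nat in auto)
    thus "card {d. d dvd d2} = (\<Sum>d | d dvd d2. dk 1 d)" by simp
  qed
  also have "\<dots> = dk 4 n"
    by (simp only: numeral_eq_Suc pred_numeral_simps One_nat_def dk.simps(2) BitM.simps arith_simps)
  finally show ?thesis by (simp add: d4_def)
qed

text \<open>Every divisor of \<open>m * n\<close> splits in some way into a divisor of
  \<open>m\<close> times a divisor of \<open>n\<close>; summing over all such pairs can only count
  it more often.\<close>

lemma dk_mult_le:
  assumes "m > 0" "n > 0"
  shows "dk k (m * n) \<le> dk k m * dk k n"
  using assms
proof (induction k arbitrary: m n)
  case (Suc k)
  have fin: "finite ({d. d dvd m} \<times> {d. d dvd n})"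
    using Suc.prems by auto
  have "{d. d dvd m * n} \<subseteq> (\<lambda>(x, y). x * y) ` ({d. d dvd m} \<times> {d. d dvd n})"
  proof
    fix d assume "d \<in> {d. d dvd m * n}"
    then obtain x y where "d = x * y" "x dvd m" "y dvd n"
      using division_decomp by blast
    thus "d \<in> (\<lambda>(x, y). x * y) ` ({d. d dvd m} \<times> {d. d dvd n})" by force
  qed
  hence "dk (Suc k) (m * n) \<le> (\<Sum>d\<in>(\<lambda>(x, y). x * y) ` ({d. d dvd m} \<times> {d. d dvd n}). dk k d)"
    unfolding dk.simps using fin by (intro sum_mono2) auto
  also have "\<dots> \<le> (\<Sum>(x, y)\<in>{d. d dvd m} \<times> {d. d dvd n}. dk k (x * y))"
    using sum_image_le[OF fin, of "dk k" "\<lambda>(x, y). x * y"] by (simp add: o_def case_prod_unfold)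
  also have "\<dots> \<le> (\<Sum>(x, y)\<in>{d. d dvd m} \<times> {d. d dvd n}. dk k x * dk k y)"
    using Suc.prems by (intro sum_mono) (auto intro!: Suc.IH dest: dvd_pos_nat)
  also have "\<dots> = dk (Suc k) m * dk (Suc k) n"
    by (simp add: sum_product sum.cartesian_product)
  finally show ?case .
qed auto

text \<open>For coprime arguments the splitting of a divisor is unique, so the pairs inject into the
  divisors of \<open>m * n\<close>. Together with the reverse inequality this is
  multiplicativity.\<close>

lemma dk_mult_ge_coprime:
  assumes "m > 0" "n > 0" "coprime m n"
  shows "dk k m * dk k n \<le> dk k (m * n)"
  using assms
proof (induction k arbitrary: m n)
  case (Suc k)
  have inj: "inj_on (\<lambda>(x, y). x * y) ({d. d dvd m} \<times> {d. d dvd n})"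
  proof (rule inj_onI, clarify)
    fix x y x' y' assume *: "x dvd m" "y dvd n" "x' dvd m" "y' dvd n" "x * y = x' * y'"
    have "coprime x y'" "coprime x' y"
      using * Suc.prems(3) coprime_divisors by blast+
    hence "x dvd x'" "x' dvd x"
      using *(5) by (metis coprime_dvd_mult_left_iff dvd_triv_left)+
    hence "x = x'" by (rule dvd_antisym)
    moreover have "x > 0" using * Suc.prems by (auto intro: dvd_pos_nat)
    ultimately show "x = x' \<and> y = y'" using * by auto
  qed
  have "dk (Suc k) m * dk (Suc k) n = (\<Sum>(x, y)\<in>{d. d dvd m} \<times> {d. d dvd n}. dk k x * dk k y)"
    by (simp add: sum_product sum.cartesian_product)
  also have "\<dots> \<le> (\<Sum>(x, y)\<in>{d. d dvd m} \<times> {d. d dvd n}. dk k (x * y))"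
    using Suc.prems by (intro sum_mono) (auto intro!: Suc.IH dest: dvd_pos_nat elim: coprime_divisors)
  also have "\<dots> = (\<Sum>d\<in>(\<lambda>(x, y). x * y) ` ({d. d dvd m} \<times> {d. d dvd n}). dk k d)"
    by (subst sum.reindex[OF inj]) (simp add: o_def case_prod_unfold)
  also have "\<dots> \<le> dk (Suc k) (m * n)"
    unfolding dk.simps using Suc.prems by (intro sum_mono2) (auto intro: mult_dvd_mono)
  finally show ?case .
qed auto

lemma dk_prime: "prime p \<Longrightarrow> dk k p = k"
proof (induction k)
  case 0 thus ?case by (auto dest: prime_gt_1_nat)
next
  case (Suc k)
  have "{d. d dvd p} = {1, p}" using Suc.prems by (auto simp: prime_nat_iff)
  thus ?case using Suc prime_gt_1_nat[of p] by (simp)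
qed

lemma dk_prod_primes_le:
  assumes "finite P" "\<And>p. p \<in> P \<Longrightarrow> prime p"
  shows "dk k (\<Prod>P) \<le> k ^ card P"
  using assms
proof (induction rule: finite_induct)
  case (insert p P)
  have "\<Prod>P > 0" using insert.prems by (intro prod_pos) (auto simp: prime_gt_0_nat)
  hence "dk k (p * \<Prod>P) \<le> dk k p * dk k (\<Prod>P)"
    using insert.prems by (intro dk_mult_le) (auto simp: prime_gt_0_nat)
  also have "\<dots> \<le> k * k ^ card P"
    using insert by (intro mult_mono) (auto simp: dk_prime)
  finally show ?case using insert by simp
qed auto

lemma prime_coprime_prod:
  assumes "finite P" "\<And>p. p \<in> P \<Longrightarrow> prime p" "prime (q::nat)" "q \<notin> P"
  shows "coprime q (\<Prod>P)"
  using assms by (intro prod_coprime_right) (metis primes_coprime)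

lemma dk_prod_primes_ge:
  assumes "finite P" "\<And>p. p \<in> P \<Longrightarrow> prime p"
  shows "k ^ card P \<le> dk k (\<Prod>P)"
  using assms
proof (induction rule: finite_induct)
  case (insert p P)
  have "\<Prod>P > 0" using insert.prems by (intro prod_pos) (auto simp: prime_gt_0_nat)
  hence "dk k p * dk k (\<Prod>P) \<le> dk k (p * \<Prod>P)"
    using insert by (intro dk_mult_ge_coprime prime_coprime_prod) (auto simp: prime_gt_0_nat)
  moreover have "k * k ^ card P \<le> dk k p * dk k (\<Prod>P)"
    using insert by (intro mult_mono) (auto simp: dk_prime)
  ultimately show ?case using insert by simp
qed auto

lemma dk_mono_Suc: "n > 0 \<Longrightarrow> k \<ge> 1 \<Longrightarrow> dk k n \<le> dk (Suc k) n"
  by (auto intro!: member_le_sum)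

lemma dk_mono: "n > 0 \<Longrightarrow> 1 \<le> k \<Longrightarrow> k \<le> l \<Longrightarrow> dk k n \<le> dk l n"
proof (induction l)
  case (Suc l)
  show ?case
  proof (cases "k = Suc l")
    case False
    hence "dk k n \<le> dk l n" using Suc by auto
    also have "\<dots> \<le> dk (Suc l) n" using Suc.prems False by (intro dk_mono_Suc) auto
    finally show ?thesis .
  qed auto
qed auto

section \<open>Logarithmic averages of divisor functions\<close>

text \<open>Writing \<open>n = d * e\<close> maps the pairs \<open>(n, d)\<close> injectively into a
  square; nonnegativity of \<open>f\<close> then permits completing the region below the hyperbola
  to that square.\<close>

lemma sum_divisors_le:
  fixes f :: "nat \<Rightarrow> nat \<Rightarrow> real"
  assumes "\<And>d e. f d e \<ge> 0"
  shows "(\<Sum>n\<in>{1..Q}. \<Sum>d | d dvd n. f d (n div d)) \<le> (\<Sum>d\<in>{1..Q}. \<Sum>e\<in>{1..Q}. f d e)"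
proof -
  let ?S = "SIGMA n:{1..Q}. {d. d dvd n}"
  let ?h = "\<lambda>(n, d). (d, n div d)"
  have "(\<Sum>n\<in>{1..Q}. \<Sum>d | d dvd n. f d (n div d)) = (\<Sum>(n, d)\<in>?S. f d (n div d))"
    by (subst sum.Sigma) auto
  also have "\<dots> = (\<Sum>(d, e)\<in>?h ` ?S. f d e)"
    by (subst sum.reindex) (auto simp: inj_on_def case_prod_unfold elim!: dvdE)
  also have "\<dots> \<le> (\<Sum>(d, e)\<in>{1..Q}\<times>{1..Q}. f d e)"
  proof (rule sum_mono2)
    show "?h ` ?S \<subseteq> {1..Q} \<times> {1..Q}"
    proof clarsimp
      fix n d assume *: "Suc 0 \<le> n" "n \<le> Q" "d dvd n"
      hence "d \<le> n" "d > 0" "n div d > 0" "n div d \<le> n"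
        by (auto simp: dvd_imp_le dvd_pos_nat div_greater_zero_iff)
      thus "Suc 0 \<le> d \<and> d \<le> Q \<and> Suc 0 \<le> n div d \<and> n div d \<le> Q" using * by linarith
    qed
  qed (use assms in auto)
  also have "\<dots> = (\<Sum>d\<in>{1..Q}. \<Sum>e\<in>{1..Q}. f d e)"
    by (subst sum.cartesian_product) auto
  finally show ?thesis .
qed

lemma harmonic_sum_le:
  assumes "Q \<ge> 1"
  shows "(\<Sum>n\<in>{1..Q}. 1 / real n) \<le> 1 + ln (real Q)"
  using assms
proof (induction Q rule: dec_induct)
  case (step n)
  \<comment> \<open>The inequality \<open>ln z \<le> z - 1\<close> at \<open>z = n / (n + 1)\<close>
    bounds the new term by the increment of the logarithm.\<close>
  have "ln (real n / real (Suc n)) \<le> real n / real (Suc n) - 1"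
    using step by (intro ln_le_minus_one) auto
  also have "real n / real (Suc n) - 1 = - 1 / real (Suc n)"
    by (simp add: field_simps)
  finally have "1 / real (Suc n) \<le> ln (real (Suc n)) - ln (real n)"
    using step by (simp add: ln_div)
  thus ?case using step by simp
qed auto

text \<open>Since \<open>1 / n\<close> factors along \<open>n = d * e\<close>, each convolution with
  the constant 1 costs one harmonic sum, that is one factor \<open>1 + ln Q\<close>.\<close>

lemma sum_dk_div_le:
  assumes "Q \<ge> 1"
  shows "(\<Sum>n\<in>{1..Q}. real (dk k n) / real n) \<le> (1 + ln (real Q)) ^ k"
proof (induction k)
  case 0
  have "(\<Sum>n\<in>{1..Q}. real (dk 0 n) / real n) = (\<Sum>n\<in>{1..Q}. if n = 1 then 1 else 0)"
    by (intro sum.cong) auto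
  also have "\<dots> \<le> 1" using assms by (subst sum.delta) auto
  finally show ?case by simp
next
  case (Suc k)
  have "(\<Sum>n\<in>{1..Q}. real (dk (Suc k) n) / real n) =
        (\<Sum>n\<in>{1..Q}. \<Sum>d | d dvd n. real (dk k d) / real d * (1 / real (n div d)))"
    by (intro sum.cong refl) (auto simp: sum_divide_distrib real_of_nat_div intro!: sum.cong)
  also have "\<dots> \<le> (\<Sum>d\<in>{1..Q}. \<Sum>e\<in>{1..Q}. real (dk k d) / real d * (1 / real e))"
    by (rule sum_divisors_le) auto
  also have "\<dots> = (\<Sum>d\<in>{1..Q}. real (dk k d) / real d) * (\<Sum>e\<in>{1..Q}. 1 / real e)"
    by (simp add: sum_product)
  also have "\<dots> \<le> (1 + ln (real Q)) ^ k * (1 + ln (real Q))"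
    using Suc assms by (intro mult_mono harmonic_sum_le sum_nonneg) auto
  finally show ?case by (simp add: mult.commute)
qed

section \<open>The divisor bound\<close>

text \<open>Each step of the recursion sums over the \<open>a + 1\<close> powers of \<open>p\<close>
  dividing \<open>p ^ a\<close>. The bound is polynomial in \<open>a\<close>, which suits small
  primes.\<close>

lemma dk_prime_power_le:
  assumes "prime p"
  shows "dk k (p ^ a) \<le> (a + 1) ^ k"
proof (induction k arbitrary: a)
  case (Suc k)
  have "{d. d dvd p ^ a} = (\<lambda>i. p ^ i) ` {..a}"
    using assms by (auto simp: divides_primepow_nat le_imp_power_dvd)
  hence "dk (Suc k) (p ^ a) \<le> (\<Sum>i\<le>a. dk k (p ^ i))"
    using sum_image_le[of "{..a}" "dk k" "\<lambda>i. p ^ i"] by (simp add: o_def)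
  also have "\<dots> \<le> (\<Sum>i\<le>a. (a + 1) ^ k)"
    by (intro sum_mono order.trans[OF Suc.IH] power_mono) auto
  finally show ?case by simp
qed auto

text \<open>Submultiplicativity peels off one prime at a time. This bound suits large primes, where
  \<open>k \<le> p powr \<kappa>\<close>.\<close>

lemma dk_prime_power_le':
  assumes "prime p"
  shows "dk k (p ^ a) \<le> k ^ a"
proof (induction a)
  case (Suc a)
  have "dk k (p * p ^ a) \<le> dk k p * dk k (p ^ a)"
    using assms by (intro dk_mult_le) (auto simp: prime_gt_0_nat)
  also have "\<dots> \<le> k * k ^ a" using Suc assms by (auto simp: dk_prime)
  finally show ?case by simp
qed auto

text \<open>Only the finitely many primes up to a threshold \<open>y\<close> can have
  \<open>dk k (p ^ a)\<close> above \<open>(p ^ a) powr \<kappa>\<close>, and each of them exceeds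
  it by a bounded factor \<open>B\<close> at most.\<close>

lemma dk_le_powr:
  assumes "\<kappa> > 0"
  shows "\<exists>C>0. \<forall>n>0. real (dk k n) \<le> C * real n powr \<kappa>"
proof -
  have "eventually (\<lambda>a::nat. (real a + 1) ^ k \<le> 2 powr (\<kappa> * real a)) at_top"
    using assms by real_asymp
  then obtain a0 where a0: "\<And>a. a \<ge> a0 \<Longrightarrow> (real a + 1) ^ k \<le> 2 powr (\<kappa> * real a)"
    by (auto simp: eventually_at_top_linorder)
  \<comment> \<open>\<open>B\<close> covers the exponents \<open>a < a0\<close>, where the
    polynomial may still exceed the exponential.\<close>
  define B where "B = (real a0 + 1) ^ k"
  have B1: "B \<ge> 1" unfolding B_def by simp
  have B: "(real a + 1) ^ k \<le> B * 2 powr (\<kappa> * real a)" for a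
  proof (cases "a \<ge> a0")
    case True
    have "2 powr (\<kappa> * real a) \<le> B * 2 powr (\<kappa> * real a)" using B1 by simp
    thus ?thesis using a0[OF True] by linarith
  next
    case False
    have "(real a + 1) ^ k \<le> B * 1" unfolding B_def mult_1_right using False by (intro power_mono) auto
    also have "\<dots> \<le> B * 2 powr (\<kappa> * real a)"
      using B1 assms by (intro mult_left_mono ge_one_powr_ge_zero) auto
    finally show ?thesis .
  qed
  define y where "y = nat \<lceil>real k powr (1 / \<kappa>)\<rceil>"
  have large: "real k \<le> real p powr \<kappa>" if "p > y" for p
  proof (cases "k = 0")
    case False
    have "real k powr (1 / \<kappa>) \<le> real p" using that unfolding y_def by linarith
    hence "(real k powr (1 / \<kappa>)) powr \<kappa> \<le> real p powr \<kappa>"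
      using assms by (intro powr_mono2) auto
    thus ?thesis using assms False by (simp add: powr_powr)
  qed auto
  have step: "real (dk k (p ^ a)) \<le> (if p \<le> y then B else 1) * real (p ^ a) powr \<kappa>" if p: "prime p" for p a
  proof (cases "p \<le> y")
    case True
    have "real (dk k (p ^ a)) \<le> (real a + 1) ^ k"
      using dk_prime_power_le[OF p, of k a] by (metis of_nat_1 of_nat_add of_nat_le_iff of_nat_power)
    also have "\<dots> \<le> B * 2 powr (\<kappa> * real a)" by (rule B)
    also have "2 powr (\<kappa> * real a) = (2 ^ a) powr \<kappa>"
      by (simp add: powr_powr mult.commute flip: powr_realpow)
    also have "\<dots> \<le> real (p ^ a) powr \<kappa>"
      using prime_ge_2_nat[OF p] assms by (intro powr_mono2) (auto intro!: power_mono)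
    finally show ?thesis using True B1 by simp
  next
    case False
    have "real (dk k (p ^ a)) \<le> real k ^ a"
      using dk_prime_power_le'[OF p, of k a] by (metis of_nat_le_iff of_nat_power)
    also have "\<dots> \<le> (real p powr \<kappa>) ^ a"
      using large[of p] False by (intro power_mono) auto
    also have "\<dots> = real (p ^ a) powr \<kappa>"
      using prime_gt_0_nat[OF p] by (simp add: powr_powr powr_power mult.commute flip: powr_realpow)
    finally show ?thesis using False by simp
  qed
  \<comment> \<open>The induction removes a full prime power at once, so the exponent of
    \<open>B\<close> counts distinct small primes and is at most \<open>y + 1\<close>.\<close>
  have main: "real (dk k n) \<le> B ^ card {p. prime p \<and> p dvd n \<and> p \<le> y} * real n powr \<kappa>" if "n > 0" for n
    using that
  proof (induction n rule: less_induct)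
    case (less n)
    show ?case
    proof (cases "n = 1")
      case False
      then obtain p where p: "prime p" "p dvd n" using prime_factor_nat by blast
      define a where "a = multiplicity p n"
      obtain m where m: "n = p ^ a * m" "\<not> p dvd m"
        using multiplicity_decompose'[of n p] p less.prems unfolding a_def by (metis not_prime_unit not_gr0)
      have a: "a > 0" using p m by (metis gr0I mult_1 power_0)
      have m0: "m > 0" using less.prems m by (metis gr0I mult_0_right)
      have "p ^ a > 1" using a p by (metis one_less_power prime_gt_1_nat)
      hence mn: "m < n" using m m0 by simp
      let ?S = "\<lambda>n. {p. prime p \<and> p dvd n \<and> p \<le> y}"
      have fin: "finite (?S n)" for n by (rule finite_subset[of _ "{..y}"]) auto
      have "real (dk k n) \<le> real (dk k (p ^ a)) * real (dk k m)"
        using dk_mult_le[of "p ^ a" m k] m m0 p prime_gt_0_nat by (metis of_nat_le_iff of_nat_mult zero_less_power)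
      also have "\<dots> \<le> ((if p \<le> y then B else 1) * real (p ^ a) powr \<kappa>) * (B ^ card (?S m) * real m powr \<kappa>)"
        using less.IH[OF mn m0] step[OF p(1)] B1 by (intro mult_mono) auto
      also have "\<dots> = ((if p \<le> y then B else 1) * B ^ card (?S m)) * real n powr \<kappa>"
        using m by (simp add: powr_mult)
      also have "(if p \<le> y then B else 1) * B ^ card (?S m) \<le> B ^ card (?S n)"
      proof (cases "p \<le> y")
        case True
        have "Suc (card (?S m)) = card (insert p (?S m))" using m fin by simp
        also have "\<dots> \<le> card (?S n)" using fin p True m by (intro card_mono) auto
        finally have "B ^ Suc (card (?S m)) \<le> B ^ card (?S n)" using B1 by (intro power_increasing) auto
        thus ?thesis using True by simp
      next
        case False
        have "card (?S m) \<le> card (?S n)" using fin m by (intro card_mono) auto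
        thus ?thesis using False B1 by (auto intro: power_increasing)
      qed
      finally show ?thesis by (simp add: mult_right_mono)
    qed (use B1 in auto)
  qed
  have "real (dk k n) \<le> B ^ Suc y * real n powr \<kappa>" if "n > 0" for n
  proof -
    have "card {p. prime p \<and> p dvd n \<and> p \<le> y} \<le> card {..y}" by (intro card_mono) auto
    hence "B ^ card {p. prime p \<and> p dvd n \<and> p \<le> y} \<le> B ^ Suc y"
      using B1 by (intro power_increasing) auto
    thus ?thesis using main[OF that] by (meson mult_right_mono order.trans powr_ge_zero)
  qed
  moreover have "B ^ Suc y > 0" using B1 by simp
  ultimately show ?thesis by blast
qed

section \<open>Majorizing the divisor function by small divisors\<close>

text \<open>Induction removing the four largest elements: choosing exactly two out of each group of four
  costs at most half of the total size up to the factor \<open>M\<close>, and \<open>6 * 7\<^sup>2 = 294 \<ge> 4 ^ 4\<close>.\<close>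

lemma four_power_le_sum_subsets:
  fixes P :: "nat set"
  assumes "finite P" "\<And>p. p \<in> P \<Longrightarrow> 0 < p \<and> p \<le> M" "M > 0"
  shows "4 ^ card P \<le> 64 * (\<Sum>S | S \<subseteq> P \<and> (\<Prod>S)\<^sup>2 \<le> \<Prod>P * M\<^sup>2. (7::nat) ^ card S)"
  using assms
proof (induction "card P" arbitrary: P M rule: less_induct)
  case less
  let ?F = "\<lambda>P M. {S. S \<subseteq> P \<and> (\<Prod>S)\<^sup>2 \<le> \<Prod>P * M\<^sup>2}"
  show ?case
  proof (cases "card P \<le> 3")
    case True
    \<comment> \<open>With at most three elements the empty subset alone suffices, the constant 64
      being \<open>4 ^ 3\<close>.\<close>
    have "finite (?F P M)" using less.prems by (auto intro: finite_subset[OF _ finite_Collect_subsets])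
    moreover have "\<Prod>P \<ge> 1" using less.prems by (metis One_nat_def Suc_leI prod_pos)
    hence "{} \<in> ?F P M"
      using less.prems(3) by (auto simp: Suc_le_eq)
    ultimately have "7 ^ card ({} :: nat set) \<le> (\<Sum>S \<in> ?F P M. (7::nat) ^ card S)"
      by (intro member_le_sum) auto
    moreover have "(4::nat) ^ card P \<le> 4 ^ 3" using True by (intro power_increasing) auto
    ultimately show ?thesis by simp
  next
    case False
    have pick: "\<exists>x\<in>A. \<forall>y\<in>A - {x}. y < x" if "finite A" "A \<noteq> {}" for A :: "nat set"
      using that by (intro bexI[of _ "Max A"]) (auto simp: le_neq_implies_less)
    obtain d where d: "d \<in> P" "\<forall>y\<in>P - {d}. y < d" using pick[of P] False less.prems by fastforce
    define P1 where "P1 = P - {d}"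
    have P1: "finite P1" "card P1 = card P - 1" using d less.prems unfolding P1_def by auto
    obtain c where c: "c \<in> P1" "\<forall>y\<in>P1 - {c}. y < c" using pick[of P1] False P1 by fastforce
    define P2 where "P2 = P1 - {c}"
    have P2: "finite P2" "card P2 = card P - 2" using c P1 unfolding P2_def by auto
    obtain b where b: "b \<in> P2" "\<forall>y\<in>P2 - {b}. y < b" using pick[of P2] False P2 by fastforce
    define P3 where "P3 = P2 - {b}"
    have P3: "finite P3" "card P3 = card P - 3" using b P2 unfolding P3_def by auto
    obtain a where a: "a \<in> P3" "\<forall>y\<in>P3 - {a}. y < a" using pick[of P3] False P3 by fastforce
    define P' where "P' = P3 - {a}"
    have P': "finite P'" "card P' = card P - 4" using a P3 unfolding P'_def by auto
    have Peq: "P = insert d (insert c (insert b (insert a P')))"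
      using a b c d unfolding P'_def P3_def P2_def P1_def by auto
    have lt: "a < b" "b < c" "c < d" using a b c d unfolding P'_def P3_def P2_def P1_def by auto
    have P'lt: "p < a" if "p \<in> P'" for p using a that unfolding P'_def by auto
    have notin: "a \<notin> P'" "b \<notin> P'" "c \<notin> P'" "d \<notin> P'" using P'lt lt by force+
    have pos: "a > 0" "d \<le> M" using less.prems(2) unfolding Peq by auto
    let ?Q = "{a, b, c, d}"
    let ?T = "{T. T \<subseteq> ?Q \<and> card T = 2}"
    have cardQ: "card ?Q = 4" using lt by simp
    have cardT: "card ?T = 6" using n_subsets[of ?Q 2] cardQ by (simp add: choose_two)
    have finT: "finite ?T" by (rule finite_subset[of _ "Pow ?Q"]) auto
    have finF: "finite (?F P' a)" using P' by (auto intro: finite_subset[OF _ finite_Collect_subsets])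
    \<comment> \<open>The size bound for the remaining set is \<open>a\<close>, the least removed
      element, instead of \<open>M\<close>; the estimate of the products below depends on
      this.\<close>
    have IH: "4 ^ card P' \<le> 64 * (\<Sum>S \<in> ?F P' a. (7::nat) ^ card S)"
      using P'lt less.prems pos P' False by (intro less.hyps) (auto simp: Peq intro: less_imp_le)
    have prodP: "\<Prod>P = a * b * c * d * \<Prod>P'"
      unfolding Peq using notin lt P' by (simp add: mult_ac)
    have disj: "S \<inter> T = {}" if "S \<subseteq> P'" "T \<subseteq> ?Q" for S T using that notin by blast
    have Tle: "\<Prod>T \<le> c * d" if "T \<in> ?T" for T
    proof -
      from that obtain x y where xy: "T = {x, y}" "x \<noteq> y" "x \<in> ?Q" "y \<in> ?Q" by (auto simp: card_2_iff)
      hence "x \<le> c \<and> y \<le> d \<or> y \<le> c \<and> x \<le> d" using lt by auto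
      hence "x * y \<le> c * d" by (metis mult_le_mono mult.commute)
      thus ?thesis using xy by simp
    qed
    have ok: "S \<union> T \<in> ?F P M" if "S \<in> ?F P' a" "T \<in> ?T" for S T
    proof -
      have fin: "finite S" "finite T" using that P' by (auto intro: finite_subset)
      have "\<Prod>(S \<union> T) = \<Prod>S * \<Prod>T" using that fin disj by (intro prod.union_disjoint) auto
      hence "(\<Prod>(S \<union> T))\<^sup>2 = (\<Prod>S)\<^sup>2 * (\<Prod>T)\<^sup>2" by (simp add: power_mult_distrib)
      also have "\<dots> \<le> (\<Prod>P' * a\<^sup>2) * (c * d)\<^sup>2"
        using that Tle by (intro mult_mono power_mono) auto
      \<comment> \<open>Trading \<open>a * c\<close> for \<open>b * d\<close> completes the product
        of all four removed elements; the surplus \<open>d\<^sup>2\<close> is at most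
        \<open>M\<^sup>2\<close>.\<close>
      also have "\<dots> = \<Prod>P' * a * c * d * d * (a * c)" by (simp add: power2_eq_square algebra_simps)
      also have "\<dots> \<le> \<Prod>P' * a * c * d * d * (b * d)"
        using lt by (intro mult_left_mono mult_mono) auto
      also have "\<dots> = \<Prod>P * d\<^sup>2" unfolding prodP by (simp add: power2_eq_square algebra_simps)
      also have "\<dots> \<le> \<Prod>P * M\<^sup>2" using pos by (intro mult_left_mono power_mono) auto
      finally show ?thesis using that unfolding Peq by auto
    qed
    have inj: "inj_on (\<lambda>(S, T). S \<union> T) (?F P' a \<times> ?T)"
    proof (rule inj_onI, clarify)
      fix S T S' T'
      assume *: "S \<subseteq> P'" "S' \<subseteq> P'" "T \<subseteq> ?Q" "T' \<subseteq> ?Q" "S \<union> T = S' \<union> T'"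
      have "S = (S \<union> T) \<inter> P'" "S' = (S' \<union> T') \<inter> P'" using * notin by blast+
      moreover have "T = (S \<union> T) \<inter> ?Q" "T' = (S' \<union> T') \<inter> ?Q" using * notin by blast+
      ultimately show "S = S' \<and> T = T'" using * by metis
    qed
    have "4 ^ card P = 256 * (4::nat) ^ card P'"
      using P' False power_add[of "4::nat" 4 "card P - 4"] by simp
    also have "\<dots> \<le> 256 * (64 * (\<Sum>S \<in> ?F P' a. (7::nat) ^ card S))" using IH by simp
    also have "\<dots> \<le> 64 * ((\<Sum>S \<in> ?F P' a. (7::nat) ^ card S) * 294)" by simp
    also have "294 = (\<Sum>T\<in>?T. (7::nat) ^ card T)" using cardT by simp
    also have "(\<Sum>S \<in> ?F P' a. (7::nat) ^ card S) * (\<Sum>T\<in>?T. (7::nat) ^ card T) =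
        (\<Sum>(S, T)\<in>?F P' a \<times> ?T. 7 ^ card S * 7 ^ card T)"
      by (simp only: sum_product sum.cartesian_product)
    also have "\<dots> = (\<Sum>(S, T)\<in>?F P' a \<times> ?T. 7 ^ card (S \<union> T))"
    proof (intro sum.cong refl, clarify)
      fix S T assume *: "S \<subseteq> P'" "T \<subseteq> ?Q"
      have "finite S" "finite T" using * P' by (auto intro: finite_subset)
      thus "(7::nat) ^ card S * 7 ^ card T = 7 ^ card (S \<union> T)"
        using disj[OF *] by (simp add: card_Un_disjoint power_add)
    qed
    also have "\<dots> = (\<Sum>U\<in>(\<lambda>(S, T). S \<union> T) ` (?F P' a \<times> ?T). 7 ^ card U)"
      by (subst sum.reindex[OF inj]) (simp add: o_def case_prod_unfold)
    also have "\<dots> \<le> (\<Sum>U\<in>?F P M. 7 ^ card U)"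
      using ok less.prems(1) by (intro sum_mono2) (auto intro: finite_subset[OF _ finite_Collect_subsets])
    finally show ?thesis by simp
  qed
qed

text \<open>With \<open>n = v * t\<^sup>2\<close> and \<open>v\<close> squarefree, take \<open>s = gcd v t * t\<^sup>2\<close> and \<open>u = v div gcd v t\<close>.\<close>

lemma square_and_coprime_squarefree_part:
  fixes n :: nat
  assumes "n > 0"
  obtains t s u where "n = u * s" "squarefree u" "coprime u s" "t\<^sup>2 dvd n" "s \<le> t ^ 3" "t > 0"
proof -
  define t where "t = square_part n"
  define v where "v = squarefree_part n"
  have n: "n = v * t\<^sup>2" unfolding v_def t_def by (rule squarefree_decompose)
  have v: "squarefree v" unfolding v_def by auto
  have t0: "t > 0" using n assms by (auto intro!: gr0I)
  define h where "h = gcd v t"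
  have h0: "h > 0" using t0 unfolding h_def by simp
  define u where "u = v div h"
  have vu: "v = u * h" unfolding u_def h_def by simp
  \<comment> \<open>A prime shared by \<open>u\<close> and \<open>h * t\<^sup>2\<close> divides both
    \<open>v\<close> and \<open>h\<close>, so it would divide \<open>v = u * h\<close>
    twice.\<close>
  have prime_ndvd: False if "prime p" "p dvd u" "p dvd h \<or> p dvd t" for p
  proof -
    have "p dvd v" using that vu by simp
    hence "p dvd h" using that unfolding h_def by auto
    hence "p\<^sup>2 dvd v" using that vu by (simp add: power2_eq_square mult_dvd_mono)
    hence "p dvd 1" using v by (metis squarefreeD)
    thus False using that(1) by auto
  qed
  have "coprime u (h * t\<^sup>2)"
  proof (rule coprimeI)
    fix c assume c: "c dvd u" "c dvd h * t\<^sup>2"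
    show "is_unit c"
    proof (rule ccontr)
      assume "\<not> is_unit c"
      then obtain p where p: "prime p" "p dvd c" by (metis nat_dvd_1_iff_1 prime_factor_nat)
      hence "p dvd u" "p dvd h \<or> p dvd t"
        using c dvd_trans by (blast, meson prime_dvd_mult_iff prime_dvd_power dvd_trans)
      thus False using prime_ndvd p by blast
    qed
  qed
  moreover have "h * t\<^sup>2 \<le> t ^ 3"
  proof -
    have "h \<le> t" using t0 unfolding h_def by (intro dvd_imp_le) auto
    thus ?thesis by (simp add: power3_eq_cube power2_eq_square)
  qed
  moreover have "squarefree u" using v vu by (metis squarefree_mono dvd_triv_left)
  ultimately show ?thesis
    using n vu t0 by (intro that[of u "h * t\<^sup>2" t]) (auto simp: mult_ac)
qed

lemma squarefree_eq_prod_prime_factors: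
  fixes u :: nat
  assumes "squarefree u"
  shows "u = \<Prod>(prime_factors u)"
proof -
  have u0: "u \<noteq> 0" using assms by (metis not_squarefree_0)
  have "u = (\<Prod>p\<in>prime_factors u. p ^ multiplicity p u)"
    using u0 prod_prime_factors[of u] by simp
  also have "\<dots> = (\<Prod>p\<in>prime_factors u. p)"
  proof (intro prod.cong refl)
    fix p assume p: "p \<in> prime_factors u"
    hence "multiplicity p u \<le> 1" using assms u0 squarefree_factorial_semiring''[of u] by auto
    moreover have "multiplicity p u > 0" using p prime_factors_multiplicity by auto
    ultimately show "p ^ multiplicity p u = p" by (metis One_nat_def le_antisym Suc_leI power_one_right)
  qed
  finally show ?thesis by simp
qed

text \<open>Split \<open>n = u * s\<close> with \<open>u\<close> squarefree, coprime to
  \<open>s\<close>, and \<open>s \<le> y ^ 3\<close>. The primes of \<open>u\<close> above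
  \<open>y\<close> number fewer than \<open>r\<close> and cost \<open>4 ^ r\<close>; for those up to
  \<open>y\<close> the subset inequality applies with \<open>M = y\<close>, and each admissible
  subset \<open>S\<close> yields the divisor \<open>s * \<Prod>S\<close> of
  \<open>n\<close>.\<close>

lemma dk_4_le_sum_dk_7:
  fixes n y :: nat
  assumes n: "n > 0" and y: "y > 0" and no_square: "\<And>t. t\<^sup>2 dvd n \<Longrightarrow> t \<le> y"
    and few: "n < (y + 1) ^ r"
  shows "dk 4 n \<le> 64 * 4 ^ r * (\<Sum>D | D dvd n \<and> D\<^sup>2 \<le> n * y ^ 5. dk 7 D)"
proof -
  obtain t s u where dec: "n = u * s" "squarefree u" "coprime u s" "t\<^sup>2 dvd n" "s \<le> t ^ 3" "t > 0"
    using square_and_coprime_squarefree_part[OF n] by blast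
  have us0: "u > 0" "s > 0" using dec n by auto
  define E where "E = prime_factors u"
  have finE: "finite E" unfolding E_def by simp
  have primeE: "p \<in> E \<Longrightarrow> prime p" for p unfolding E_def by auto
  have uE: "u = \<Prod>E" unfolding E_def by (rule squarefree_eq_prod_prime_factors[OF dec(2)])
  define P where "P = {p\<in>E. p \<le> y}"
  define R where "R = {p\<in>E. p > y}"
  have PR: "E = P \<union> R" "P \<inter> R = {}" "finite P" "finite R" using finE unfolding P_def R_def by auto
  have posprod: "\<Prod>S > 0" if "S \<subseteq> E" for S
    using that primeE by (intro prod_pos) (auto simp: prime_gt_0_nat)
  have uPR: "u = \<Prod>P * \<Prod>R" using uE PR prod.union_disjoint by metis
  have "(y + 1) ^ card R \<le> \<Prod>R"
    using prod_mono[of R "\<lambda>_. y + 1" "\<lambda>x. x"] unfolding R_def by simp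
  also have "\<dots> \<le> n" using dec(1) uPR n by (intro dvd_imp_le) auto
  finally have "card R < r" using few y by (metis Suc_eq_plus1 le_less_trans less_add_same_cancel2 power_less_imp_less_exp)
  hence "(4::nat) ^ card R \<le> 4 ^ r" by (intro power_increasing) auto
  moreover have "dk 4 u \<le> 4 ^ card P * 4 ^ card R"
    using dk_prod_primes_le[of E 4] finE primeE PR uE by (simp add: card_Un_disjoint power_add)
  ultimately have u_le: "dk 4 u \<le> 4 ^ card P * 4 ^ r"
    by (meson dual_order.trans mult_le_mono2)
  have P_le: "4 ^ card P \<le> 64 * (\<Sum>S | S \<subseteq> P \<and> (\<Prod>S)\<^sup>2 \<le> \<Prod>P * y\<^sup>2. (7::nat) ^ card S)"
    using PR y primeE by (intro four_power_le_sum_subsets) (auto simp: P_def prime_gt_0_nat)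
  have u_bound: "dk 4 u \<le> 64 * 4 ^ r * (\<Sum>S | S \<subseteq> P \<and> (\<Prod>S)\<^sup>2 \<le> \<Prod>P * y\<^sup>2. (7::nat) ^ card S)"
    (is "_ \<le> _ * (\<Sum>S\<in>?F. _)")
    using order.trans[OF u_le mult_right_mono[OF P_le, of "4 ^ r"]] by (simp add: mult_ac)
  have inj: "inj_on (\<lambda>S. s * \<Prod>S) ?F"
  proof (rule inj_onI, clarify)
    fix S S' assume *: "S \<subseteq> P" "S' \<subseteq> P" "s * \<Prod>S = s * \<Prod>S'"
    have sub: "S \<subseteq> S'" if "S \<subseteq> P" "S' \<subseteq> P" "\<Prod>S = \<Prod>S'" for S S'
    proof
      fix p assume p: "p \<in> S"
      have fin: "finite S" "finite S'" using that(1,2) PR(3) by (auto intro: finite_subset)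
      show "p \<in> S'"
      proof (rule ccontr)
        assume "p \<notin> S'"
        hence "coprime p (\<Prod>S')"
          using that p fin primeE PR by (intro prime_coprime_prod) auto
        moreover have "p dvd \<Prod>S'" using p fin that(3) by (metis dvd_prodI)
        ultimately have "is_unit p" by (metis coprime_absorb_left)
        moreover have "prime p" using p that PR primeE by blast
        ultimately show False using not_prime_unit by blast
      qed
    qed
    show "S = S'" using sub[of S S'] sub[of S' S] * us0 by auto
  qed
  have "dk 4 n \<le> dk 4 u * dk 4 s" unfolding dec(1) using us0 by (intro dk_mult_le)
  \<comment> \<open>Weakening \<open>dk 4 s\<close> to \<open>dk 7 s\<close> lets it merge with
    \<open>7 ^ card S\<close> into \<open>dk 7\<close> of the single divisor
    \<open>s * \<Prod>S\<close>.\<close>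
  also have "\<dots> \<le> (64 * 4 ^ r * (\<Sum>S\<in>?F. 7 ^ card S)) * dk 7 s"
    using u_bound us0 by (intro mult_mono dk_mono) auto
  also have "\<dots> = 64 * 4 ^ r * (\<Sum>S\<in>?F. dk 7 s * 7 ^ card S)"
    by (simp add: sum_distrib_left mult_ac)
  also have "(\<Sum>S\<in>?F. dk 7 s * 7 ^ card S) \<le> (\<Sum>S\<in>?F. dk 7 (s * \<Prod>S))"
  proof (rule sum_mono)
    fix S assume "S \<in> ?F"
    hence S: "S \<subseteq> E" "finite S" using PR finite_subset by auto
    have "\<Prod>S dvd u" using S uE finE by (metis prod_dvd_prod_subset)
    hence "coprime s (\<Prod>S)" using dec(3) by (meson coprime_commute coprime_divisors dvd_refl)
    hence "dk 7 s * dk 7 (\<Prod>S) \<le> dk 7 (s * \<Prod>S)"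
      by (intro dk_mult_ge_coprime us0 posprod S)
    moreover have "7 ^ card S \<le> dk 7 (\<Prod>S)" using S primeE by (intro dk_prod_primes_ge) auto
    ultimately show "dk 7 s * 7 ^ card S \<le> dk 7 (s * \<Prod>S)" by (meson dual_order.trans mult_le_mono2)
  qed
  also have "\<dots> = (\<Sum>D\<in>(\<lambda>S. s * \<Prod>S) ` ?F. dk 7 D)"
    by (subst sum.reindex[OF inj]) simp
  also have "\<dots> \<le> (\<Sum>D | D dvd n \<and> D\<^sup>2 \<le> n * y ^ 5. dk 7 D)"
  proof (rule sum_mono2)
    show "(\<lambda>S. s * \<Prod>S) ` ?F \<subseteq> {D. D dvd n \<and> D\<^sup>2 \<le> n * y ^ 5}"
    proof clarify
      fix S assume S: "S \<subseteq> P" "(\<Prod>S)\<^sup>2 \<le> \<Prod>P * y\<^sup>2"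
      have "\<Prod>S dvd u" using S uE finE PR by (metis prod_dvd_prod_subset le_sup_iff sup.orderE sup_ge1)
      hence "s * \<Prod>S dvd n" using dec(1) by (simp add: mult.commute mult_dvd_mono)
      moreover have "(s * \<Prod>S)\<^sup>2 \<le> n * y ^ 5"
      proof -
        have "(s * \<Prod>S)\<^sup>2 = s * s * (\<Prod>S)\<^sup>2" by (simp add: power2_eq_square)
        \<comment> \<open>One factor \<open>s\<close> is kept to rebuild \<open>n = u * s\<close>;
          only the other is bounded by \<open>y ^ 3\<close>.\<close>
        also have "\<dots> \<le> s * y ^ 3 * (u * y\<^sup>2)"
        proof (intro mult_mono order.refl)
          have "t ^ 3 \<le> y ^ 3" using no_square dec(4) by (intro power_mono) auto
          thus "s \<le> y ^ 3" using dec(5) by linarith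
          have "\<Prod>R > 0" using PR(1) by (intro posprod) auto
          hence "\<Prod>P * 1 \<le> \<Prod>P * \<Prod>R" by (intro mult_left_mono) linarith+
          hence "\<Prod>P \<le> u" using uPR by simp
          thus "(\<Prod>S)\<^sup>2 \<le> u * y\<^sup>2" using S(2) by (meson dual_order.trans mult_le_mono1)
        qed auto
        also have "\<dots> = n * y ^ 5" using dec(1) by (simp add: power_add[symmetric] mult_ac)
        finally show ?thesis .
      qed
      ultimately show "s * \<Prod>S dvd n \<and> (s * \<Prod>S)\<^sup>2 \<le> n * y ^ 5" by blast
    qed
  qed (use n in auto)
  finally show ?thesis by simp
qed

section \<open>Fourier analysis of digit restrictions\<close>

text \<open>Strings of exactly \<open>J\<close> digits, leading zeros included and tested against
  \<open>b\<close> too. For \<open>b < g\<close> this gives \<open>(g - 1) ^ J\<close> elements and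
  a Fourier transform that factors over the positions.\<close>

definition digit_avoiding :: "nat \<Rightarrow> nat \<Rightarrow> nat \<Rightarrow> nat set" where
  "digit_avoiding g b J = {m. m < g ^ J \<and> (\<forall>i<J. m div g ^ i mod g \<noteq> b)}"

lemma finite_digit_avoiding [simp]: "finite (digit_avoiding g b J)"
  by (rule finite_subset[of _ "{..<g ^ J}"]) (auto simp: digit_avoiding_def)

lemma digit_avoiding_0 [simp]: "digit_avoiding g b 0 = {0}"
  by (auto simp: digit_avoiding_def)

lemma inj_on_append_digit: "inj_on (\<lambda>(c, m). c + g * m) (({..<g} - B) \<times> A)" for g :: nat
proof (rule inj_onI, clarify)
  fix c m c' m' :: nat assume *: "c < g" "c' < g" "c + g * m = c' + g * m'"
  have "c = (c + g * m) mod g" "c' = (c' + g * m') mod g" "m = (c + g * m) div g" "m' = (c' + g * m') div g"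
    using *(1,2) by auto
  thus "c = c' \<and> m = m'" using *(3) by metis
qed

lemma digit_avoiding_Suc:
  assumes "g > 0"
  shows "digit_avoiding g b (Suc J) = (\<lambda>(c, m). c + g * m) ` (({..<g} - {b}) \<times> digit_avoiding g b J)"
proof (intro equalityI subsetI)
  fix n assume n: "n \<in> digit_avoiding g b (Suc J)"
  have "n div g < g ^ J" using n assms by (auto simp: digit_avoiding_def less_mult_imp_div_less mult.commute)
  moreover have "n div g div g ^ i mod g \<noteq> b" if "i < J" for i
    using n that by (auto simp: digit_avoiding_def simp flip: div_mult2_eq power_Suc dest: spec[of _ "Suc i"])
  moreover have "n mod g \<noteq> b" using n by (auto simp: digit_avoiding_def dest: spec[of _ 0])
  ultimately have "(n mod g, n div g) \<in> ({..<g} - {b}) \<times> digit_avoiding g b J"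
    using assms by (auto simp: digit_avoiding_def)
  thus "n \<in> (\<lambda>(c, m). c + g * m) ` (({..<g} - {b}) \<times> digit_avoiding g b J)"
    by (rule rev_image_eqI) simp
next
  fix n assume "n \<in> (\<lambda>(c, m). c + g * m) ` (({..<g} - {b}) \<times> digit_avoiding g b J)"
  then obtain c m where cm: "n = c + g * m" "c < g" "c \<noteq> b" "m \<in> digit_avoiding g b J" by auto
  have "m + 1 \<le> g ^ J" using cm by (auto simp: digit_avoiding_def)
  hence "g * (m + 1) \<le> g * g ^ J" by (intro mult_left_mono) auto
  hence "n < g ^ Suc J" using cm by (simp add: algebra_simps)
  moreover have "n div g ^ i mod g \<noteq> b" if "i < Suc J" for i
    using that cm by (cases i) (auto simp: digit_avoiding_def div_mult2_eq)
  ultimately show "n \<in> digit_avoiding g b (Suc J)" by (auto simp: digit_avoiding_def)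
qed

lemma card_digit_avoiding:
  assumes "b < g"
  shows "card (digit_avoiding g b J) = (g - 1) ^ J"
proof (induction J)
  case (Suc J)
  have "g > 0" using assms by simp
  thus ?case using assms Suc
    by (simp add: digit_avoiding_Suc card_image[OF inj_on_append_digit] card_cartesian_product)
qed auto

section \<open>The Fourier transform as a product over digits\<close>

definition digit_fourier :: "nat \<Rightarrow> nat \<Rightarrow> nat \<Rightarrow> real \<Rightarrow> complex" where
  "digit_fourier g b J x = (\<Sum>m\<in>digit_avoiding g b J. cis (2 * pi * real m * x))"

lemma digit_fourier_0 [simp]: "digit_fourier g b 0 x = 1"
  by (simp add: digit_fourier_def)

text \<open>The lowest digit splits off, and the remaining digits, scaled by \<open>g\<close>, see
  the frequency \<open>g * x\<close>. Iteration gives a product of \<open>J\<close> one-digit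
  sums.\<close>

lemma digit_fourier_Suc:
  assumes "g > 0"
  shows "digit_fourier g b (Suc J) x = (\<Sum>c\<in>{..<g} - {b}. cis (2 * pi * real c * x)) * digit_fourier g b J (real g * x)"
proof -
  have "digit_fourier g b (Suc J) x =
    (\<Sum>(c, m)\<in>({..<g} - {b}) \<times> digit_avoiding g b J. cis (2 * pi * real (c + g * m) * x))"
    unfolding digit_fourier_def digit_avoiding_Suc[OF assms]
    by (subst sum.reindex[OF inj_on_append_digit]) (simp add: o_def case_prod_unfold)
  also have "\<dots> = (\<Sum>(c, m)\<in>({..<g} - {b}) \<times> digit_avoiding g b J.
      cis (2 * pi * real c * x) * cis (2 * pi * real m * (real g * x)))"
    by (intro sum.cong refl) (auto simp: cis_mult algebra_simps)
  also have "\<dots> = (\<Sum>c\<in>{..<g} - {b}. cis (2 * pi * real c * x)) * digit_fourier g b J (real g * x)"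
    unfolding digit_fourier_def by (simp only: sum_product sum.cartesian_product)
  finally show ?thesis .
qed

lemma cis_2pi_int: "cis (2 * pi * of_int k) = 1"
proof -
  have "cos (2 * pi * of_int k) = 1" "sin (2 * pi * of_int k) = 0"
    using cos_int_2pin[of k] sin_int_2pin[of k] by (simp_all add: mult_ac)
  thus ?thesis by (simp add: complex_eq_iff)
qed

lemma digit_fourier_add_int: "digit_fourier g b J (of_int k + x) = digit_fourier g b J x"
proof -
  have "cis (2 * pi * real m * (of_int k + x)) = cis (2 * pi * real m * x)" for m
  proof -
    have "2 * pi * real m * (of_int k + x) = 2 * pi * of_int (int m * k) + 2 * pi * real m * x"
      by (simp add: algebra_simps)
    thus ?thesis by (metis cis_2pi_int cis_mult mult_1)
  qed
  thus ?thesis unfolding digit_fourier_def by simp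
qed

definition normalized_fourier :: "nat \<Rightarrow> nat \<Rightarrow> nat \<Rightarrow> real \<Rightarrow> real" where
  "normalized_fourier g b J x = norm (digit_fourier g b J x) / real (g - 1) ^ J"

lemma normalized_fourier_nonneg [simp]: "normalized_fourier g b J x \<ge> 0"
  by (simp add: normalized_fourier_def)

lemma normalized_fourier_le_1:
  assumes "b < g" "g \<ge> 2"
  shows "normalized_fourier g b J x \<le> 1"
proof -
  have "norm (digit_fourier g b J x) \<le> (\<Sum>m\<in>digit_avoiding g b J. 1)"
    unfolding digit_fourier_def by (rule order.trans[OF norm_sum]) simp
  thus ?thesis using assms by (simp add: normalized_fourier_def card_digit_avoiding divide_le_eq_1 zero_less_power)
qed

section \<open>Size of a single digit factor\<close>

text \<open>An upper bound for the normalized one-digit sum on the cell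
  \<open>[c / g, (c + 1) / g)\<close>: the trivial bound 1 in the two cells next to the integers,
  elsewhere the geometric series bound \<open>1 / x + 1 / (1 - x)\<close> plus 1 for the missing
  digit.\<close>

definition digit_weight :: "nat \<Rightarrow> nat \<Rightarrow> real" where
  "digit_weight g c = (if c = 0 \<or> c \<ge> g - 1 then 1
     else (1 + real g / real c + real g / real (g - 1 - c)) / real (g - 1))"

lemma digit_weight_nonneg [simp]: "digit_weight g c \<ge> 0"
  by (simp add: digit_weight_def)

text \<open>The two outer cells give 2, and the inner ones give two harmonic sums, exchanged by
  \<open>c \<mapsto> g - 1 - c\<close>, times \<open>g / (g - 1)\<close>. This is the source of the
  factor \<open>log g\<close> per digit.\<close>

lemma sum_digit_weight_le:
  assumes "g \<ge> 3"
  shows "(\<Sum>c<g. digit_weight g c) \<le> 7 + 4 * ln (real g)"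
proof -
  define H where "H = (\<Sum>c\<in>{1..g-2}. 1 / real c)"
  have H: "H \<le> 1 + ln (real g)"
  proof -
    have "H \<le> 1 + ln (real (g - 2))" unfolding H_def using assms by (intro harmonic_sum_le) auto
    also have "ln (real (g - 2)) \<le> ln (real g)" using assms by simp
    finally show ?thesis by simp
  qed
  have H0: "H \<ge> 0" unfolding H_def by (intro sum_nonneg) auto
  have set: "{..<g} = insert 0 (insert (g - 1) {1..g-2})" using assms by auto
  have refl: "(\<Sum>c\<in>{1..g-2}. 1 / real (g - 1 - c)) = H"
    unfolding H_def by (rule sum.reindex_bij_witness[of _ "\<lambda>c. g - 1 - c" "\<lambda>c. g - 1 - c"]) auto
  have "(\<Sum>c<g. digit_weight g c) = 2 + (\<Sum>c\<in>{1..g-2}. digit_weight g c)"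
  proof -
    have "(\<Sum>c<g. digit_weight g c) = digit_weight g 0 + (digit_weight g (g - 1) + (\<Sum>c\<in>{1..g-2}. digit_weight g c))"
      unfolding set using assms by (subst sum.insert; (subst sum.insert)?; auto)
    thus ?thesis by (simp add: digit_weight_def)
  qed
  also have "(\<Sum>c\<in>{1..g-2}. digit_weight g c) =
     (\<Sum>c\<in>{1..g-2}. (1 + real g * (1 / real c) + real g * (1 / real (g - 1 - c))) / real (g - 1))"
    by (intro sum.cong refl) (auto simp: digit_weight_def)
  also have "\<dots> = (real (g - 2) + real g * H + real g * H) / real (g - 1)"
    unfolding sum_divide_distrib[symmetric] sum.distrib sum_distrib_left[symmetric] refl H_def[symmetric]
    by simp
  also have "\<dots> \<le> 1 + 4 * H"
  proof -
    have "real (g - 2) + real g * H + real g * H \<le> (1 + 4 * H) * real (g - 1)"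
    proof -
      have "H * 0 \<le> H * (real g - 2)" using H0 assms by (intro mult_left_mono) auto
      thus ?thesis using assms by (simp add: of_nat_diff algebra_simps)
    qed
    thus ?thesis using assms by (simp add: divide_le_eq)
  qed
  finally show ?thesis using H by simp
qed

text \<open>Up to \<open>pi / 3\<close> the derivative of the sine is at least one half; beyond, the
  sine is at least \<open>sqrt 3 / 2\<close> while \<open>x / 3\<close> is below
  \<open>2 / 3\<close>. The slope \<open>1 / 3\<close> suffices for
  \<open>x \<le> sin (pi * x)\<close> on \<open>[0, 1 / 2]\<close> because
  \<open>pi \<ge> 3\<close>.\<close>

lemma sin_ge_third:
  assumes "0 \<le> x" "x \<le> pi / 2"
  shows "x / 3 \<le> sin x"
proof (cases "x \<le> pi / 3")
  case True
  have "sin 0 - 0 / 3 \<le> sin x - x / 3"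
  proof (rule DERIV_nonneg_imp_nondecreasing[OF assms(1)])
    fix y assume y: "0 \<le> y" "y \<le> x"
    have "cos (pi / 3) \<le> cos y" using y True assms by (intro cos_monotone_0_pi_le) auto
    hence "cos y - 1 / 3 \<ge> 0" by (simp add: cos_60)
    moreover have "((\<lambda>x. sin x - x / 3) has_real_derivative (cos y - 1 / 3)) (at y)"
      by (auto intro!: derivative_eq_intros)
    ultimately show "\<exists>z. ((\<lambda>x. sin x - x / 3) has_real_derivative z) (at y) \<and> 0 \<le> z" by blast
  qed
  thus ?thesis by simp
next
  case False
  have "sin (pi / 3) \<le> sin x" using False assms by (intro sin_monotone_2pi_le) auto
  moreover have "x / 3 \<le> 2 / 3" using assms pi_less_4 by simp
  moreover have "4 / 3 \<le> sqrt 3" by (rule real_le_rsqrt) (simp add: power2_eq_square)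
  ultimately show ?thesis by (simp add: sin_60)
qed

lemma pi_ge_3: "pi \<ge> 3"
  using sin_x_le_x[of "pi / 6"] by (simp add: sin_30)

lemma inverse_sin_pi_le:
  assumes "0 < x" "x < 1"
  shows "1 / sin (pi * x) \<le> 1 / x + 1 / (1 - x)"
proof -
  have *: "1 / sin (pi * x) \<le> 1 / x" if "0 < x" "x \<le> 1 / 2" for x
  proof -
    have "x \<le> pi * x / 3" using that pi_ge_3 by simp
    also have "\<dots> \<le> sin (pi * x)" using that by (intro sin_ge_third) auto
    finally show ?thesis using that by (intro divide_left_mono mult_pos_pos) auto
  qed
  show ?thesis
  proof (cases "x \<le> 1 / 2")
    case True
    have "1 / (1 - x) \<ge> 0" using assms by simp
    thus ?thesis using *[of x] True assms by linarith
  next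
    case False
    have "sin (pi * (1 - x)) = sin (pi * x)" by (simp add: algebra_simps sin_diff)
    hence "1 / sin (pi * x) \<le> 1 / (1 - x)" using *[of "1 - x"] False assms by simp
    moreover have "1 / x \<ge> 0" using assms by simp
    ultimately show ?thesis by linarith
  qed
qed

text \<open>A geometric series with numerator at most 2 in norm and denominator of norm
  \<open>2 * sin (pi * x)\<close>, so the bound is uniform in \<open>g\<close>.\<close>

lemma norm_sum_cis_le:
  assumes "0 < x" "x < 1"
  shows "norm (\<Sum>c<g. cis (2 * pi * real c * x)) \<le> 1 / x + 1 / (1 - x)"
proof -
  define z where "z = cis (2 * pi * x)"
  have sin: "sin (pi * x) > 0" using assms by (intro sin_gt_zero) auto
  have nz: "norm (1 - z) = 2 * sin (pi * x)"
  proof -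
    have "(norm (1 - z))\<^sup>2 = (1 - cos (2 * (pi * x)))\<^sup>2 + (sin (2 * (pi * x)))\<^sup>2"
      unfolding z_def cmod_power2 by (simp add: mult_ac)
    also have "\<dots> = (2 * sin (pi * x))\<^sup>2"
    proof -
      have "(sin (2 * (pi * x)))\<^sup>2 = 1 - (cos (2 * (pi * x)))\<^sup>2" by (rule sin_squared_eq)
      moreover have "cos (2 * (pi * x)) = 1 - 2 * (sin (pi * x))\<^sup>2" by (rule cos_double_sin)
      ultimately show ?thesis by algebra
    qed
    finally show ?thesis by (rule power2_eq_imp_eq) (use sin in auto)
  qed
  have "z \<noteq> 1" using nz sin by auto
  have "(\<Sum>c<g. cis (2 * pi * real c * x)) = (\<Sum>c<g. z ^ c)"
    unfolding z_def by (intro sum.cong refl) (simp add: DeMoivre mult_ac)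
  also have "norm \<dots> = norm (1 - z ^ g) / norm (1 - z)"
    using \<open>z \<noteq> 1\<close> by (simp add: sum_gp_strict norm_divide)
  also have "\<dots> \<le> 2 / (2 * sin (pi * x))"
  proof -
    have "norm (1 - z ^ g) \<le> norm (1::complex) + norm (z ^ g)" by (rule norm_triangle_ineq4)
    also have "\<dots> = 2" by (simp add: z_def norm_power)
    finally show ?thesis unfolding nz using sin by (intro divide_right_mono) auto
  qed
  also have "\<dots> = 1 / sin (pi * x)" by simp
  also have "\<dots> \<le> 1 / x + 1 / (1 - x)" by (rule inverse_sin_pi_le[OF assms])
  finally show ?thesis .
qed

text \<open>The digit sum is the full geometric sum minus one unit vector. In the cell with index
  \<open>c0\<close> one has \<open>x \<ge> c0 / g\<close> and
  \<open>1 - x \<ge> (g - 1 - c0) / g\<close>.\<close>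

lemma norm_digit_sum_le:
  assumes "b < g" "g \<ge> 2" "0 \<le> x" "x < 1"
  shows "norm (\<Sum>c\<in>{..<g} - {b}. cis (2 * pi * real c * x)) / real (g - 1) \<le> digit_weight g (nat \<lfloor>real g * x\<rfloor>)"
proof -
  define c0 where "c0 = nat \<lfloor>real g * x\<rfloor>"
  have c0: "real c0 \<le> real g * x" "real g * x < real c0 + 1"
    unfolding c0_def using assms by (auto simp: of_nat_nat)
  show ?thesis
  proof (cases "c0 = 0 \<or> c0 \<ge> g - 1")
    case True
    have "norm (\<Sum>c\<in>{..<g} - {b}. cis (2 * pi * real c * x)) \<le> (\<Sum>c\<in>{..<g} - {b}. 1)"
      by (rule order.trans[OF norm_sum]) simp
    also have "\<dots> = real (g - 1)" using assms by simp
    finally show ?thesis using True assms unfolding c0_def by (simp add: digit_weight_def divide_le_eq_1)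
  next
    case False
    hence F: "c0 > 0" "c0 < g - 1" by auto
    have x0: "x > 0" using c0 F assms by (cases "x = 0") auto
    have "norm (\<Sum>c\<in>{..<g} - {b}. cis (2 * pi * real c * x)) =
        norm ((\<Sum>c<g. cis (2 * pi * real c * x)) - cis (2 * pi * real b * x))"
      using assms by (simp add: sum_diff1)
    also have "\<dots> \<le> norm (\<Sum>c<g. cis (2 * pi * real c * x)) + norm (cis (2 * pi * real b * x))"
      by (rule norm_triangle_ineq4)
    also have "\<dots> \<le> (1 / x + 1 / (1 - x)) + 1"
      using norm_sum_cis_le[OF x0 assms(4)] by simp
    also have "1 / x \<le> real g / real c0"
      using c0 F x0 by (simp add: field_simps)
    also have "1 / (1 - x) \<le> real g / real (g - 1 - c0)"
    proof -
      have "real (g - 1 - c0) = real g - 1 - real c0" using F by simp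
      moreover have "\<dots> > 0" using F by linarith
      ultimately show ?thesis using c0 assms by (simp add: field_simps)
    qed
    finally show ?thesis using False assms unfolding c0_def[symmetric]
      by (simp add: digit_weight_def divide_right_mono)
  qed
qed

text \<open>The index \<open>c < g ^ i\<close> stands for the cell \<open>[c / g ^ i, (c + 1) / g ^ i)\<close>. Only \<open>min i J\<close> leading
  digits of \<open>c\<close> carry a weight: finer cells gain nothing beyond the \<open>J\<close> factors of the product, and
  coarser ones only see the first \<open>i\<close> of them.\<close>

fun cell_weight :: "nat \<Rightarrow> nat \<Rightarrow> nat \<Rightarrow> nat \<Rightarrow> real" where
  "cell_weight g 0 i c = 1"
| "cell_weight g (Suc J) 0 c = 1"
| "cell_weight g (Suc J) (Suc i) c = digit_weight g (c div g ^ i) * cell_weight g J i (c mod g ^ i)"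

lemma cell_weight_nonneg [simp]: "cell_weight g J i c \<ge> 0"
  by (induction g J i c rule: cell_weight.induct) auto

text \<open>The weight is a product over the digits of \<open>c\<close>, so the sum factors: each of
  the \<open>min i J\<close> weighted digits gives the total digit weight, each of the others the
  number \<open>g\<close> of its choices.\<close>

lemma sum_cell_weight:
  assumes "g > 0"
  shows "(\<Sum>c<g ^ i. cell_weight g J i c) = (\<Sum>c<g. digit_weight g c) ^ min i J * real g ^ (i - J)"
proof (induction J arbitrary: i)
  case (Suc J)
  show ?case
  proof (cases i)
    case i: (Suc i')
    have "(\<Sum>c<g ^ i. cell_weight g (Suc J) i c) =
      (\<Sum>c0<g. \<Sum>c\<in>{c0 * g ^ i'..<c0 * g ^ i' + g ^ i'}. cell_weight g (Suc J) i c)"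
      unfolding i by (simp add: sum.nat_group)
    also have "\<dots> = (\<Sum>c0<g. \<Sum>c'<g ^ i'. digit_weight g c0 * cell_weight g J i' c')"
    proof (rule sum.cong[OF refl])
      fix c0
      have "(\<Sum>c\<in>{c0 * g ^ i'..<c0 * g ^ i' + g ^ i'}. cell_weight g (Suc J) i c) =
            (\<Sum>c'\<in>{0..<g ^ i'}. cell_weight g (Suc J) i (c' + c0 * g ^ i'))"
        using sum.shift_bounds_nat_ivl[of "cell_weight g (Suc J) i" 0 "c0 * g ^ i'" "g ^ i'"]
        by (simp add: add.commute)
      also have "\<dots> = (\<Sum>c'\<in>{0..<g ^ i'}. digit_weight g c0 * cell_weight g J i' c')"
        using assms unfolding i by (intro sum.cong refl) simp
      finally show "(\<Sum>c\<in>{c0 * g ^ i'..<c0 * g ^ i' + g ^ i'}. cell_weight g (Suc J) i c) =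
          (\<Sum>c'<g ^ i'. digit_weight g c0 * cell_weight g J i' c')" by (simp add: atLeast0LessThan)
    qed
    also have "\<dots> = (\<Sum>c0<g. digit_weight g c0) * (\<Sum>c'<g ^ i'. cell_weight g J i' c')"
      by (simp only: sum_product)
    finally show ?thesis unfolding Suc i by simp
  qed simp
qed simp

text \<open>The integer part \<open>k\<close> of \<open>g * x\<close> is the leading digit of the
  cell index and controls the first factor. By periodicity the other factors depend only on the
  fractional part \<open>x'\<close>, whose cell has the remaining digits as index.\<close>

lemma normalized_fourier_le_cell_weight:
  assumes "b < g" "g \<ge> 2" "0 \<le> x" "x < 1"
  shows "normalized_fourier g b J x \<le> cell_weight g J i (nat \<lfloor>real (g ^ i) * x\<rfloor>)"
  using assms(3,4)
proof (induction J arbitrary: i x)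
  case 0
  thus ?case by (simp add: normalized_fourier_def)
next
  case (Suc J)
  show ?case
  proof (cases i)
    case 0
    thus ?thesis using normalized_fourier_le_1[OF assms(1,2)] by simp
  next
    case i: (Suc i')
    define k where "k = \<lfloor>real g * x\<rfloor>"
    define x' where "x' = real g * x - of_int k"
    have x': "0 \<le> x'" "x' < 1" unfolding x'_def k_def by linarith+
    have k0: "k \<ge> 0" unfolding k_def using Suc.prems by simp
    define l where "l = \<lfloor>real (g ^ i') * x'\<rfloor>"
    have l: "l \<ge> 0" "l < int (g ^ i')"
    proof -
      show "l \<ge> 0" unfolding l_def using x' by simp
      have "real (g ^ i') * x' < real (g ^ i') * 1"
        using x' assms by (intro mult_strict_left_mono) auto
      thus "l < int (g ^ i')" unfolding l_def by (simp add: floor_less_iff)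
    qed
    define w where "w = int (g ^ i') * k"
    have "real (g ^ i) * x = of_int w + real (g ^ i') * x'"
      unfolding i x'_def w_def by (simp add: algebra_simps)
    hence "\<lfloor>real (g ^ i) * x\<rfloor> = w + l"
      unfolding l_def by simp
    hence fl: "nat \<lfloor>real (g ^ i) * x\<rfloor> = nat k * g ^ i' + nat l"
      using k0 l unfolding w_def by (simp add: nat_add_distrib nat_mult_distrib nat_power_eq mult.commute)
    have "normalized_fourier g b (Suc J) x =
       norm (\<Sum>c\<in>{..<g} - {b}. cis (2 * pi * real c * x)) / real (g - 1) * normalized_fourier g b J (real g * x)"
      using assms by (simp add: normalized_fourier_def digit_fourier_Suc norm_mult)
    also have "normalized_fourier g b J (real g * x) = normalized_fourier g b J x'"
      using digit_fourier_add_int[of g b J k x'] unfolding normalized_fourier_def x'_def by simp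
    also have "norm (\<Sum>c\<in>{..<g} - {b}. cis (2 * pi * real c * x)) / real (g - 1) * normalized_fourier g b J x'
        \<le> digit_weight g (nat k) * cell_weight g J i' (nat l)"
      unfolding k_def l_def using x' Suc.prems assms
      by (intro mult_mono norm_digit_sum_le Suc.IH) auto
    also have "\<dots> = cell_weight g (Suc J) i (nat \<lfloor>real (g ^ i) * x\<rfloor>)"
    proof -
      have "nat l < g ^ i'" using l by linarith
      moreover have "(nat k * g ^ i' + nat l) div g ^ i' = nat k + nat l div g ^ i'"
        by (rule div_mult_self3) (use assms in auto)
      ultimately show ?thesis unfolding fl unfolding i by simp
    qed
    finally show ?thesis .
  qed
qed

section \<open>Sums over reduced fractions\<close>

text \<open>For \<open>q = 1\<close> only \<open>a = 0\<close> occurs; that frequency carries the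
  expected main term.\<close>

definition reduced_fourier_sum :: "nat \<Rightarrow> nat \<Rightarrow> nat \<Rightarrow> nat \<Rightarrow> real" where
  "reduced_fourier_sum g b J q = (\<Sum>a | a < q \<and> coprime a q. normalized_fourier g b J (real a / real q))"

lemma reduced_fourier_sum_nonneg [simp]: "reduced_fourier_sum g b J q \<ge> 0"
  unfolding reduced_fourier_sum_def by (intro sum_nonneg) auto

lemma reduced_fraction_unique:
  fixes a q a' q' :: nat
  assumes "coprime a q" "coprime a' q'" "a * q' = a' * q" "q > 0" "q' > 0"
  shows "a = a' \<and> q = q'"
proof -
  have "q dvd a * q'" "q' dvd a' * q" using assms(3) by (metis dvd_triv_right)+
  hence "q dvd q'" "q' dvd q"
    using assms(1,2) by (metis coprime_commute coprime_dvd_mult_right_iff)+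
  hence "q = q'" by (rule dvd_antisym)
  thus ?thesis using assms by auto
qed

text \<open>Distinct reduced fractions with denominators at most \<open>Q\<close> differ by at least \<open>1 / Q\<^sup>2\<close>, hence lie in
  different cells as soon as \<open>Q\<^sup>2 \<le> g ^ i\<close>.\<close>

lemma sum_reduced_fourier_sum_le:
  assumes "b < g" "g \<ge> 2"
  shows "(\<Sum>q | q \<ge> 1 \<and> q\<^sup>2 \<le> g ^ i. reduced_fourier_sum g b J q)
     \<le> (\<Sum>c<g. digit_weight g c) ^ min i J * real g ^ (i - J)"
proof -
  let ?Q = "{q::nat. q \<ge> 1 \<and> q\<^sup>2 \<le> g ^ i}"
  let ?S = "SIGMA q:?Q. {a. a < q \<and> coprime a q}"
  let ?h = "\<lambda>(q, a). nat \<lfloor>real (g ^ i) * (real a / real q)\<rfloor>"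
  have finQ: "finite ?Q"
  proof (rule finite_subset[of _ "{..g ^ i}"])
    show "?Q \<subseteq> {..g ^ i}" using power2_nat_le_imp_le by blast
  qed auto
  have gi: "real (g ^ i) > 0" using assms by simp
  have inj: "inj_on ?h ?S"
  proof (rule inj_onI, clarify)
    fix q a q' a' :: nat
    assume *: "1 \<le> q" "q\<^sup>2 \<le> g ^ i" "a < q" "coprime a q" "1 \<le> q'" "q'\<^sup>2 \<le> g ^ i" "a' < q'" "coprime a' q'"
      and eq: "nat \<lfloor>real (g ^ i) * (real a / real q)\<rfloor> = nat \<lfloor>real (g ^ i) * (real a' / real q')\<rfloor>"
    have "\<lfloor>real (g ^ i) * (real a / real q)\<rfloor> = \<lfloor>real (g ^ i) * (real a' / real q')\<rfloor>"
      using eq by (simp add: eq_nat_nat_iff)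
    hence "\<bar>real (g ^ i) * (real a / real q) - real (g ^ i) * (real a' / real q')\<bar> < 1" by linarith
    hence "\<bar>real (g ^ i) * (real a * real q' - real a' * real q) / (real q * real q')\<bar> < 1"
      using * by (simp add: field_simps)
    hence "real (g ^ i) * \<bar>real a * real q' - real a' * real q\<bar> < real q * real q'"
      using * by (simp add: abs_mult divide_less_eq)
    also have "real q * real q' \<le> real (g ^ i)"
    proof -
      have "(q * q')\<^sup>2 \<le> g ^ i * g ^ i" unfolding power_mult_distrib using * by (intro mult_mono) auto
      hence "q * q' \<le> g ^ i" by (metis power2_eq_square power2_nat_le_eq_le)
      thus ?thesis by (metis of_nat_le_iff of_nat_mult)
    qed
    finally have "\<bar>real a * real q' - real a' * real q\<bar> < 1" using gi by simp
    hence "\<bar>int (a * q') - int (a' * q)\<bar> < 1" by (simp flip: of_int_less_iff[where 'a = real])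
    hence "a * q' = a' * q" by linarith
    thus "q = q' \<and> a = a'" using reduced_fraction_unique[of a q a' q'] * by auto
  qed
  have "(\<Sum>q\<in>?Q. reduced_fourier_sum g b J q) =
      (\<Sum>(q, a)\<in>?S. normalized_fourier g b J (real a / real q))"
    unfolding reduced_fourier_sum_def using finQ by (subst sum.Sigma) auto
  also have "\<dots> \<le> (\<Sum>(q, a)\<in>?S. cell_weight g J i (?h (q, a)))"
  proof (rule sum_mono)
    fix z assume "z \<in> ?S"
    then obtain q a where z: "z = (q, a)" "q \<ge> 1" "a < q" by auto
    show "(case z of (q, a) \<Rightarrow> normalized_fourier g b J (real a / real q)) \<le>
          (case z of (q, a) \<Rightarrow> cell_weight g J i (?h (q, a)))"
      unfolding z(1) case_prod_conv
      by (rule normalized_fourier_le_cell_weight[OF assms]) (use z in auto)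
  qed
  also have "\<dots> = (\<Sum>c\<in>?h ` ?S. cell_weight g J i c)"
    by (subst sum.reindex[OF inj]) (simp add: o_def case_prod_unfold)
  also have "\<dots> \<le> (\<Sum>c<g ^ i. cell_weight g J i c)"
  proof (intro sum_mono2)
    show "?h ` ?S \<subseteq> {..<g ^ i}"
    proof (rule image_subsetI, clarify)
      fix q a :: nat assume *: "1 \<le> q" "a < q"
      have "real (g ^ i) * (real a / real q) < real (g ^ i) * 1"
        using * gi by (intro mult_strict_left_mono) auto
      hence "\<lfloor>real (g ^ i) * (real a / real q)\<rfloor> < int (g ^ i)" by (simp add: floor_less_iff)
      moreover have "g ^ i > 0" using assms by simp
      ultimately show "nat \<lfloor>real (g ^ i) * (real a / real q)\<rfloor> < g ^ i" by linarith
    qed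
  qed auto
  also have "\<dots> = (\<Sum>c<g. digit_weight g c) ^ min i J * real g ^ (i - J)"
    using assms by (intro sum_cell_weight) auto
  finally show ?thesis .
qed

section \<open>Divisibility detected by additive characters\<close>

text \<open>Orthogonality of characters: the terms are powers of a \<open>D\<close>-th root of
  unity, which equals 1 exactly when \<open>D\<close> divides \<open>k\<close>.\<close>

lemma sum_cis_multiples:
  fixes D k :: nat
  assumes "D > 0"
  shows "(\<Sum>r<D. cis (2 * pi * real k * (real r / real D))) = (if D dvd k then of_nat D else 0)"
proof -
  define z where "z = cis (2 * pi * (real k / real D))"
  have pow: "cis (2 * pi * real k * (real r / real D)) = z ^ r" for r
    unfolding z_def by (simp add: DeMoivre mult_ac)
  have zD: "z ^ D = 1"
    using cis_2pi_int[of "int k"] assms unfolding pow[symmetric] by simp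
  show ?thesis
  proof (cases "D dvd k")
    case True
    then obtain l where "k = D * l" by auto
    hence "z = 1" unfolding z_def using cis_2pi_int[of "int l"] assms by simp
    thus ?thesis unfolding pow using True by simp
  next
    case False
    have "z \<noteq> 1"
    proof
      assume "z = 1"
      hence "cos (2 * pi * (real k / real D)) = 1" unfolding z_def by (simp add: complex_eq_iff)
      then obtain n :: int where "2 * pi * (real k / real D) = of_int n * 2 * pi"
        using cos_one_2pi_int by auto
      hence "(2 * pi) * (real k / real D) = (2 * pi) * of_int n" by (simp only: mult_ac)
      hence "real k / real D = of_int n" by (subst (asm) mult_left_cancel) auto
      hence "real k = of_int n * real D" using assms by (simp add: field_simps)
      hence "int k = n * int D" by (metis of_int_eq_iff of_int_mult of_int_of_nat_eq)
      hence "int D dvd int k" by simp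
      thus False using False by simp
    qed
    thus ?thesis unfolding pow using False zD by (simp add: sum_gp_strict)
  qed
qed

text \<open>Reducing \<open>r / D\<close> to lowest terms gives distinct reduced fractions whose
  denominators divide \<open>D\<close>.\<close>

lemma sum_normalized_fourier_le:
  assumes "D > 0"
  shows "(\<Sum>r<D. normalized_fourier g b J (real r / real D)) \<le> (\<Sum>q | q dvd D. reduced_fourier_sum g b J q)"
proof -
  let ?S = "SIGMA q:{q. q dvd D}. {a. a < q \<and> coprime a q}"
  let ?h = "\<lambda>r. (D div gcd r D, r div gcd r D)"
  have fin: "finite {q. q dvd D}" using assms by simp
  have quot: "real (r div gcd r D) / real (D div gcd r D) = real r / real D" for r
    using assms by (simp add: real_of_nat_div)
  have inj: "inj_on ?h {..<D}"
  proof (rule inj_onI)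
    fix r r' assume "?h r = ?h r'"
    hence "r div gcd r D = r' div gcd r' D" "D div gcd r D = D div gcd r' D" by auto
    hence "real r / real D = real r' / real D" by (metis quot)
    thus "r = r'" using assms by simp
  qed
  have "(\<Sum>r<D. normalized_fourier g b J (real r / real D)) =
     (\<Sum>(q, a)\<in>?h ` {..<D}. normalized_fourier g b J (real a / real q))"
    by (subst sum.reindex[OF inj]) (simp add: o_def quot)
  also have "\<dots> \<le> (\<Sum>(q, a)\<in>?S. normalized_fourier g b J (real a / real q))"
  proof (rule sum_mono2)
    show "finite ?S" using fin by auto
    show "?h ` {..<D} \<subseteq> ?S"
    proof clarsimp
      fix r assume r: "r < D"
      have "coprime (r div gcd r D) (D div gcd r D)" using assms by (intro div_gcd_coprime) auto
      moreover have "D div gcd r D dvd D" by (metis dvd_div_mult_self dvd_triv_left gcd_dvd2)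
      moreover have "r div gcd r D < D div gcd r D"
        using r assms by (intro div_less_mono) auto
      ultimately show "D div gcd r D dvd D \<and> r div gcd r D < D div gcd r D \<and> coprime (r div gcd r D) (D div gcd r D)"
        by blast
    qed
  qed auto
  also have "\<dots> = (\<Sum>q | q dvd D. reduced_fourier_sum g b J q)"
    unfolding reduced_fourier_sum_def using fin by (subst sum.Sigma) auto
  finally show ?thesis .
qed

text \<open>In the character sum the shift \<open>X\<close> enters only through phases of modulus
  one, so the bound is uniform in \<open>X\<close>.\<close>

lemma card_multiples_le:
  assumes "D > 0" "b < g" "g \<ge> 2"
  shows "real (card {m \<in> digit_avoiding g b J. D dvd X + m})
     \<le> real (g - 1) ^ J / real D * (\<Sum>q | q dvd D. reduced_fourier_sum g b J q)"
proof -
  let ?A = "digit_avoiding g b J"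
  have "of_nat D * complex_of_real (real (card {m \<in> ?A. D dvd X + m})) =
     (\<Sum>m\<in>?A. if D dvd X + m then of_nat D else (0::complex))"
    by (simp add: sum.If_cases Int_def mult.commute)
  also have "\<dots> = (\<Sum>m\<in>?A. \<Sum>r<D. cis (2 * pi * real (X + m) * (real r / real D)))"
    by (intro sum.cong refl) (rule sum_cis_multiples[OF assms(1), symmetric])
  also have "\<dots> = (\<Sum>r<D. \<Sum>m\<in>?A. cis (2 * pi * real (X + m) * (real r / real D)))"
    by (rule sum.swap)
  also have "\<dots> = (\<Sum>r<D. cis (2 * pi * real X * (real r / real D)) * digit_fourier g b J (real r / real D))"
    unfolding digit_fourier_def sum_distrib_left
    by (intro sum.cong refl) (simp add: cis_mult algebra_simps add_divide_distrib)
  finally have "norm (of_nat D * complex_of_real (real (card {m \<in> ?A. D dvd X + m}))) =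
      norm (\<Sum>r<D. cis (2 * pi * real X * (real r / real D)) * digit_fourier g b J (real r / real D))"
    by simp
  also have "\<dots> \<le> (\<Sum>r<D. norm (digit_fourier g b J (real r / real D)))"
    by (rule order.trans[OF norm_sum]) (simp add: norm_mult)
  also have "\<dots> = real (g - 1) ^ J * (\<Sum>r<D. normalized_fourier g b J (real r / real D))"
    using assms by (simp add: normalized_fourier_def sum_distrib_left)
  also have "\<dots> \<le> real (g - 1) ^ J * (\<Sum>q | q dvd D. reduced_fourier_sum g b J q)"
    by (intro mult_left_mono sum_normalized_fourier_le assms) auto
  finally have "real D * real (card {m \<in> ?A. D dvd X + m}) \<le> \<dots>"
    by (simp add: norm_mult)
  thus ?thesis using assms by (simp add: field_simps)
qed

section \<open>Restricted integers divisible by a given number\<close>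

abbreviation total_digit_weight :: "nat \<Rightarrow> real" where
  "total_digit_weight g \<equiv> (\<Sum>c<g. digit_weight g c)"

text \<open>The exponent \<open>19/40\<close> is half of \<open>19/20 = 1 - 1/20\<close>: the weight \<open>d\<^sub>7 q / q\<close> is \<open>O(q powr (-19/20))\<close>
  and \<open>q\<^sup>2 \<approx> g ^ i\<close>. The range \<open>i \<le> 9/5 * J\<close> suffices since \<open>Q\<^sup>2 \<approx> X powr (21/20)\<close>,
  \<open>g ^ J \<ge> c * X powr (3/5)\<close> and \<open>3/5 * 9/5 = 27/25 > 21/20\<close>.\<close>

lemma cell_bound_decay:
  assumes g: "g \<ge> 3" and L: "4 * total_digit_weight g \<le> real g powr (1/20)"
    and i: "real i \<le> 9/5 * real J"
  shows "total_digit_weight g ^ min i J * real g ^ (i - J) * real g powr (- (19/40) * real i) \<le> (1/2) ^ i"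
proof -
  have L0: "total_digit_weight g \<ge> 0" by (intro sum_nonneg) auto
  have pow: "total_digit_weight g ^ k \<le> (1/4) ^ k * real g powr (real k / 20)" for k
  proof -
    have "total_digit_weight g ^ k \<le> (1/4 * real g powr (1/20)) ^ k"
      using L L0 by (intro power_mono) auto
    also have "\<dots> = (1/4) ^ k * real g powr (real k / 20)"
      using g by (simp only: power_mult_distrib) (simp add: powr_powr flip: powr_realpow)
    finally show ?thesis .
  qed
  show ?thesis
  proof (cases "i \<le> J")
    case True
    have "total_digit_weight g ^ min i J * real g ^ (i - J) * real g powr (- (19/40) * real i)
        = total_digit_weight g ^ i * real g powr (- (19/40) * real i)"
      using True by (simp add: min_def)
    also have "\<dots> \<le> (1/4) ^ i * real g powr (real i / 20) * real g powr (- (19/40) * real i)"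
      by (intro mult_right_mono pow) auto
    also have "\<dots> = (1/4) ^ i * real g powr (real i / 20 - 19/40 * real i)"
      by (simp add: powr_add[symmetric] mult.assoc)
    also have "\<dots> \<le> (1/4) ^ i * real g powr 0"
      using g by (intro mult_left_mono powr_mono) auto
    also have "\<dots> \<le> (1/2) ^ i" using g by (simp add: power_mono)
    finally show ?thesis .
  next
    case False
    have "total_digit_weight g ^ min i J * real g ^ (i - J) * real g powr (- (19/40) * real i)
        = total_digit_weight g ^ J * real g powr (real i - real J) * real g powr (- (19/40) * real i)"
      using False g by (simp add: min_def of_nat_diff flip: powr_realpow)
    also have "\<dots> \<le> (1/4) ^ J * real g powr (real J / 20) * real g powr (real i - real J) * real g powr (- (19/40) * real i)"
      by (intro mult_right_mono pow) auto
    also have "\<dots> = (1/4) ^ J * real g powr (real J / 20 + (real i - real J) - 19/40 * real i)"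
      by (simp add: powr_add[symmetric] mult.assoc)
    \<comment> \<open>The exponent is \<open>21/40 * i - 19/20 * J\<close>, and
      \<open>21/40 * 9/5 = 189/200\<close> is just below \<open>19/20\<close>.\<close>
    also have "\<dots> \<le> (1/4) ^ J * real g powr 0"
      using g i by (intro mult_left_mono powr_mono) auto
    also have "\<dots> = (1/2) ^ (2 * J)" using g by (simp add: power_mult power2_eq_square)
    also have "\<dots> \<le> (1/2) ^ i" using i by (intro power_decreasing) auto
    finally show ?thesis .
  qed
qed

text \<open>The denominators are grouped by the scale \<open>i\<close> with \<open>q\<^sup>2\<close>
  comparable to \<open>g ^ i\<close>. Each group is bounded by the sum over all cells of that scale,
  and the weight leaves a geometric series in \<open>i\<close>.\<close>

lemma weighted_reduced_fourier_sum_le: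
  assumes g: "g \<ge> 3" and b: "b < g" and L: "4 * total_digit_weight g \<le> real g powr (1/20)"
    and Q: "real g * (real Q)\<^sup>2 \<le> real (g ^ J) powr (9/5)"
  shows "(\<Sum>q\<in>{1..Q}. reduced_fourier_sum g b J q * real q powr (-19/20)) \<le> 2 * real g"
proof -
  \<comment> \<open>Minimality of the level keeps \<open>g ^ lev q\<close> within a factor
    \<open>g\<close> of \<open>q\<^sup>2\<close>, and this factor is the reason for \<open>g\<close>
    in the hypothesis on \<open>Q\<close>.\<close>
  define lev where "lev q = (LEAST i. q\<^sup>2 \<le> g ^ i)" for q :: nat
  have lev: "q\<^sup>2 \<le> g ^ lev q" for q
  proof -
    have "q\<^sup>2 < g ^ (q\<^sup>2)" using g by (intro less_exp[THEN less_le_trans] power_mono) auto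
    thus ?thesis unfolding lev_def by (intro LeastI) (rule less_imp_le)
  qed
  have lev': "g ^ lev q \<le> g * q\<^sup>2" if "q \<ge> 1" for q
  proof (cases "lev q")
    case 0
    thus ?thesis using that g by (simp add: Suc_le_eq)
  next
    case (Suc i)
    hence "\<not> q\<^sup>2 \<le> g ^ i" unfolding lev_def by (intro not_less_Least) auto
    thus ?thesis using Suc by simp
  qed
  define T where "T = {i::nat. real i \<le> 9/5 * real J}"
  have T: "T \<subseteq> {..<2 * J + 1}" unfolding T_def by auto
  hence finT: "finite T" using finite_subset by blast
  have sub: "lev ` {1..Q} \<subseteq> T"
  proof
    fix i assume "i \<in> lev ` {1..Q}"
    then obtain q where q: "i = lev q" "1 \<le> q" "q \<le> Q" by auto
    have "real g powr real i = real (g ^ i)" using g by (simp add: powr_realpow)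
    also have "\<dots> \<le> real g * (real q)\<^sup>2"
      using lev'[OF q(2)] q(1) by (metis of_nat_le_iff of_nat_mult of_nat_power)
    also have "\<dots> \<le> real g * (real Q)\<^sup>2" using q by (intro mult_left_mono power_mono) auto
    also have "\<dots> \<le> real (g ^ J) powr (9/5)" by (rule Q)
    also have "\<dots> = real g powr (9/5 * real J)" using g by (simp add: powr_powr mult.commute flip: powr_realpow)
    finally show "i \<in> T" unfolding T_def using g by simp
  qed
  have "(\<Sum>q\<in>{1..Q}. reduced_fourier_sum g b J q * real q powr (-19/20)) =
      (\<Sum>i\<in>T. \<Sum>q | q \<in> {1..Q} \<and> lev q = i. reduced_fourier_sum g b J q * real q powr (-19/20))"
    by (rule sum.group[symmetric, OF finite_atLeastAtMost finT sub])
  also have "\<dots> \<le> (\<Sum>i\<in>T. real g * (1/2) ^ i)"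
  proof (rule sum_mono)
    fix i assume i: "i \<in> T"
    have "(\<Sum>q | q \<in> {1..Q} \<and> lev q = i. reduced_fourier_sum g b J q * real q powr (-19/20))
       \<le> (\<Sum>q | q \<in> {1..Q} \<and> lev q = i. reduced_fourier_sum g b J q * (real g * real g powr (- (19/40) * real i)))"
    proof (intro sum_mono mult_left_mono)
      fix q assume q: "q \<in> {q. q \<in> {1..Q} \<and> lev q = i}"
      \<comment> \<open>Raising this to the power \<open>-19/40\<close> turns the weight of
        \<open>q\<close> into a function of the level, at a cost of
        \<open>g powr (19/40) \<le> g\<close>.\<close>
      have "real g ^ i \<le> real g * (real q)\<^sup>2"
        using lev'[of q] q by (metis (mono_tags, lifting) atLeastAtMost_iff mem_Collect_eq of_nat_le_iff of_nat_mult of_nat_power)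
      hence "(real g * (real q)\<^sup>2) powr (-19/40) \<le> (real g ^ i) powr (-19/40)"
        using g by (intro powr_mono2') auto
      moreover have "(real g * (real q)\<^sup>2) powr (-19/40) = real g powr (-19/40) * real q powr (-19/20)"
      proof -
        have sq: "(real q)\<^sup>2 = real q powr 2" using q by simp
        have "(real q powr 2) powr (-19/40) = real q powr (-19/20)" by (simp only: powr_powr) simp
        thus ?thesis unfolding sq powr_mult by (simp only:)
      qed
      moreover have "(real g ^ i) powr (-19/40) = real g powr (- (19/40) * real i)"
      proof -
        have pw: "real g ^ i = real g powr real i" using g by (simp add: powr_realpow)
        show ?thesis unfolding pw powr_powr by (rule arg_cong[where f = "\<lambda>z. real g powr z"]) simp
      qed
      ultimately have "real g powr (-19/40) * real q powr (-19/20) \<le> real g powr (- (19/40) * real i)"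
        by simp
      hence "real g powr (19/40) * (real g powr (-19/40) * real q powr (-19/20)) \<le> real g powr (19/40) * real g powr (- (19/40) * real i)"
        by (intro mult_left_mono) auto
      also have "\<dots> \<le> real g powr 1 * real g powr (- (19/40) * real i)"
        using g by (intro mult_right_mono powr_mono) auto
      also have "real g powr (19/40) * (real g powr (-19/40) * real q powr (-19/20)) = real q powr (-19/20)"
        using g by (simp add: mult.assoc[symmetric] powr_add[symmetric])
      finally show "real q powr (-19/20) \<le> real g * real g powr (- (19/40) * real i)" using g by simp
    qed auto
    also have "\<dots> = (\<Sum>q | q \<in> {1..Q} \<and> lev q = i. reduced_fourier_sum g b J q) * (real g * real g powr (- (19/40) * real i))"
      by (simp only: sum_distrib_right)
    also have "\<dots> \<le> (total_digit_weight g ^ min i J * real g ^ (i - J)) * (real g * real g powr (- (19/40) * real i))"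
    proof (intro mult_right_mono)
      have "finite {q. q \<ge> 1 \<and> q\<^sup>2 \<le> g ^ i}"
        by (rule finite_subset[of _ "{..g ^ i}"]) (use power2_nat_le_imp_le in blast)+
      hence "(\<Sum>q | q \<in> {1..Q} \<and> lev q = i. reduced_fourier_sum g b J q)
        \<le> (\<Sum>q | q \<ge> 1 \<and> q\<^sup>2 \<le> g ^ i. reduced_fourier_sum g b J q)"
        using lev by (intro sum_mono2) auto
      also have "\<dots> \<le> total_digit_weight g ^ min i J * real g ^ (i - J)"
        using b g by (intro sum_reduced_fourier_sum_le) auto
      finally show "(\<Sum>q | q \<in> {1..Q} \<and> lev q = i. reduced_fourier_sum g b J q) \<le> \<dots>" .
    qed auto
    also have "\<dots> = real g * (total_digit_weight g ^ min i J * real g ^ (i - J) * real g powr (- (19/40) * real i))"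
      by (simp only: mult_ac)
    also have "\<dots> \<le> real g * (1/2) ^ i"
      using i unfolding T_def by (intro mult_left_mono cell_bound_decay g L) auto
    finally show "(\<Sum>q | q \<in> {1..Q} \<and> lev q = i. reduced_fourier_sum g b J q * real q powr (-19/20)) \<le> real g * (1/2) ^ i" .
  qed
  also have "\<dots> \<le> (\<Sum>i<2 * J + 1. real g * (1/2) ^ i)" using T by (intro sum_mono2) auto
  also have "\<dots> = real g * (\<Sum>i<2 * J + 1. (1/2) ^ i)" by (simp only: sum_distrib_left)
  also have "\<dots> \<le> real g * 2"
    by (rule mult_left_mono) (simp_all only: sum_gp_strict, simp_all)
  finally show ?thesis by simp
qed

text \<open>After exchanging summations, \<open>D = q * e\<close> and submultiplicativity separate
  the sum. The part in \<open>q\<close> is weighted by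
  \<open>dk k q / q \<le> C * q powr (-19/20)\<close> and stays bounded by the Fourier estimate; the
  part in \<open>e\<close> gives the power of the logarithm.\<close>

lemma sum_dk_divisors_le:
  assumes g: "g \<ge> 3" and b: "b < g" and L: "4 * total_digit_weight g \<le> real g powr (1/20)"
    and Q: "real g * (real Q)\<^sup>2 \<le> real (g ^ J) powr (9/5)" "Q \<ge> 1"
    and C: "\<And>n. n > 0 \<Longrightarrow> real (dk k n) \<le> C * real n powr (1/20)" "C > 0"
  shows "(\<Sum>m\<in>digit_avoiding g b J. \<Sum>D | D \<in> {1..Q} \<and> D dvd X + m. real (dk k D))
     \<le> 2 * real g * C * (1 + ln (real Q)) ^ k * real (g - 1) ^ J"
proof -
  let ?A = "digit_avoiding g b J"
  define f where "f q e = real (dk k q) / real q * reduced_fourier_sum g b J q * (real (dk k e) / real e)" for q e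
  have f0: "f q e \<ge> 0" for q e unfolding f_def by simp
  have "(\<Sum>m\<in>?A. \<Sum>D | D \<in> {1..Q} \<and> D dvd X + m. real (dk k D)) =
     (\<Sum>D\<in>{1..Q}. \<Sum>m | m \<in> ?A \<and> D dvd X + m. real (dk k D))"
    using sum.swap_restrict[of ?A "{1..Q}" "\<lambda>m D. real (dk k D)" "\<lambda>m D. D dvd X + m"] by simp
  also have "\<dots> = (\<Sum>D\<in>{1..Q}. real (dk k D) * real (card {m \<in> ?A. D dvd X + m}))"
    by (simp add: mult.commute)
  also have "\<dots> \<le> (\<Sum>D\<in>{1..Q}. real (g - 1) ^ J * (\<Sum>q | q dvd D. f q (D div q)))"
  proof (rule sum_mono)
    fix D assume D: "D \<in> {1..Q}"
    have "real (dk k D) * real (card {m \<in> ?A. D dvd X + m})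
      \<le> real (dk k D) * (real (g - 1) ^ J / real D * (\<Sum>q | q dvd D. reduced_fourier_sum g b J q))"
      using D b g by (intro mult_left_mono card_multiples_le) auto
    also have "\<dots> = real (g - 1) ^ J * (\<Sum>q | q dvd D. real (dk k D) / real D * reduced_fourier_sum g b J q)"
      by (simp add: sum_distrib_left sum_divide_distrib mult_ac)
    also have "\<dots> \<le> real (g - 1) ^ J * (\<Sum>q | q dvd D. f q (D div q))"
    proof (intro mult_left_mono sum_mono)
      fix q assume "q \<in> {q. q dvd D}"
      then obtain e where e: "D = q * e" by auto
      hence pos: "q > 0" "e > 0" using D by (auto intro!: gr0I)
      have "real (dk k D) \<le> real (dk k q) * real (dk k e)"
        unfolding e using dk_mult_le[OF pos, of k] by (metis of_nat_le_iff of_nat_mult)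
      hence "real (dk k D) / real D \<le> real (dk k q) * real (dk k e) / real D"
        by (intro divide_right_mono) auto
      hence "real (dk k D) / real D * reduced_fourier_sum g b J q
        \<le> real (dk k q) * real (dk k e) / real D * reduced_fourier_sum g b J q"
        by (intro mult_right_mono) auto
      also have "\<dots> = f q (D div q)" unfolding f_def e using pos by simp
      finally show "real (dk k D) / real D * reduced_fourier_sum g b J q \<le> f q (D div q)" .
    qed auto
    finally show "real (dk k D) * real (card {m \<in> ?A. D dvd X + m}) \<le> \<dots>" .
  qed
  also have "\<dots> = real (g - 1) ^ J * (\<Sum>D\<in>{1..Q}. \<Sum>q | q dvd D. f q (D div q))"
    by (simp only: sum_distrib_left)
  also have "\<dots> \<le> real (g - 1) ^ J * (\<Sum>q\<in>{1..Q}. \<Sum>e\<in>{1..Q}. f q e)"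
    by (intro mult_left_mono sum_divisors_le f0) auto
  also have "(\<Sum>q\<in>{1..Q}. \<Sum>e\<in>{1..Q}. f q e) =
     (\<Sum>q\<in>{1..Q}. real (dk k q) / real q * reduced_fourier_sum g b J q) * (\<Sum>e\<in>{1..Q}. real (dk k e) / real e)"
    unfolding f_def by (simp only: sum_product)
  also have "\<dots> \<le> (C * (2 * real g)) * (1 + ln (real Q)) ^ k"
  proof (intro mult_mono sum_dk_div_le Q(2))
    have "(\<Sum>q\<in>{1..Q}. real (dk k q) / real q * reduced_fourier_sum g b J q) \<le>
      (\<Sum>q\<in>{1..Q}. C * (reduced_fourier_sum g b J q * real q powr (-19/20)))"
    proof (rule sum_mono)
      fix q assume q: "q \<in> {1..Q}"
      have "real (dk k q) / real q \<le> C * real q powr (1/20) / real q"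
        using q C by (intro divide_right_mono) auto
      also have "\<dots> = C * (real q powr (1/20) / real q powr 1)" using q by simp
      also have "\<dots> = C * real q powr (1/20 - 1)" by (simp only: powr_diff)
      finally have "real (dk k q) / real q \<le> C * real q powr (-19/20)" by simp
      hence "real (dk k q) / real q * reduced_fourier_sum g b J q \<le> C * real q powr (-19/20) * reduced_fourier_sum g b J q"
        by (intro mult_right_mono) auto
      thus "real (dk k q) / real q * reduced_fourier_sum g b J q \<le> C * (reduced_fourier_sum g b J q * real q powr (-19/20))"
        by (simp only: mult_ac)
    qed
    also have "\<dots> = C * (\<Sum>q\<in>{1..Q}. reduced_fourier_sum g b J q * real q powr (-19/20))"
      by (simp only: sum_distrib_left)
    also have "\<dots> \<le> C * (2 * real g)"
      using C by (intro mult_left_mono weighted_reduced_fourier_sum_le g b L Q) auto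
    finally show "(\<Sum>q\<in>{1..Q}. real (dk k q) / real q * reduced_fourier_sum g b J q) \<le> C * (2 * real g)" .
  qed (use C in \<open>auto intro: sum_nonneg\<close>)
  finally have "(\<Sum>m\<in>?A. \<Sum>D | D \<in> {1..Q} \<and> D dvd X + m. real (dk k D)) \<le>
    real (g - 1) ^ J * ((C * (2 * real g)) * (1 + ln (real Q)) ^ k)"
    by (simp add: mult_left_mono)
  thus ?thesis by (simp add: mult_ac)
qed

section \<open>Integers with a large square divisor\<close>

text \<open>Two solutions are at least \<open>D\<close> apart, hence have different quotients by
  \<open>D\<close>.\<close>

lemma card_multiples_below_le:
  fixes D :: nat
  assumes "D > 0"
  shows "real (card {m. m < N \<and> D dvd X + m}) \<le> real N / real D + 1"
proof -
  have "inj_on (\<lambda>m. m div D) {m. m < N \<and> D dvd X + m}"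
  proof (rule linorder_inj_onI')
    fix m m' assume *: "m \<in> {m. m < N \<and> D dvd X + m}" "m' \<in> {m. m < N \<and> D dvd X + m}" "m < m'"
    have "D dvd (X + m') - (X + m)" using * by (intro dvd_diff_nat) auto
    hence "D \<le> m' - m" using * by (intro dvd_imp_le) auto
    hence "(m + D) div D \<le> m' div D" using * by (intro div_le_mono) auto
    thus "m div D \<noteq> m' div D" using assms by simp
  qed
  moreover have "(\<lambda>m. m div D) ` {m. m < N \<and> D dvd X + m} \<subseteq> {..N div D}"
    by (auto intro: div_le_mono)
  ultimately have "card {m. m < N \<and> D dvd X + m} \<le> N div D + 1"
    using card_inj_on_le[of "\<lambda>m. m div D" _ "{..N div D}"] by simp
  hence "real (card {m. m < N \<and> D dvd X + m}) \<le> real (N div D) + 1" by linarith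
  also have "real (N div D) \<le> real N / real D" by (rule of_nat_div_le_of_nat)
  finally show ?thesis by simp
qed

lemma sum_inverse_squares_le:
  assumes "y > 0" "y \<le> T"
  shows "(\<Sum>t\<in>{y<..T}. 1 / (real t)\<^sup>2) \<le> 1 / real y - 1 / real T"
  using assms(2)
proof (induction T rule: dec_induct)
  case (step T)
  have "{y<..Suc T} = insert (Suc T) {y<..T}" using step by auto
  moreover have "1 / (real (Suc T))\<^sup>2 \<le> 1 / real T - 1 / real (Suc T)"
  proof -
    have "1 / (real (Suc T))\<^sup>2 \<le> 1 / (real T * real (Suc T))"
      using step assms unfolding power2_eq_square by (intro divide_left_mono mult_right_mono mult_pos_pos) auto
    also have "\<dots> = 1 / real T - 1 / real (Suc T)" using step assms by (simp add: field_simps)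
    finally show ?thesis .
  qed
  ultimately show ?case using step.IH by simp
qed auto

text \<open>A union bound over \<open>t\<close> up to \<open>sqrt (2 * X)\<close>, the largest
  possible since \<open>X + m \<le> 2 * X\<close>. Each \<open>t\<close> contributes at most
  \<open>N / t\<^sup>2 + 1\<close>; the terms 1 add up to the square root.\<close>

lemma card_large_square_divisor_le:
  assumes "y > 0" "N \<le> X"
  shows "real (card {m. m < N \<and> (\<exists>t>y. t\<^sup>2 dvd X + m)}) \<le> real N / real y + sqrt (2 * real X)"
proof -
  define T where "T = nat \<lfloor>sqrt (2 * real X)\<rfloor>"
  have T: "real T \<le> sqrt (2 * real X)" unfolding T_def by simp
  let ?B = "\<lambda>t. {m. m < N \<and> t\<^sup>2 dvd X + m}"
  have "{m. m < N \<and> (\<exists>t>y. t\<^sup>2 dvd X + m)} \<subseteq> (\<Union>t\<in>{y<..T}. ?B t)"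
  proof clarify
    fix m t assume *: "m < N" "y < t" "t\<^sup>2 dvd X + m"
    have "t\<^sup>2 \<le> X + m" using * assms by (intro dvd_imp_le) auto
    also have "\<dots> \<le> 2 * X" using * assms by simp
    finally have "real (t\<^sup>2) \<le> real (2 * X)" by (simp only: of_nat_le_iff)
    hence "(real t)\<^sup>2 \<le> 2 * real X" by simp
    hence "real t \<le> sqrt (2 * real X)" by (rule real_le_rsqrt)
    hence "t \<le> T" unfolding T_def by (simp add: le_nat_floor)
    thus "m \<in> (\<Union>t\<in>{y<..T}. ?B t)" using * by auto
  qed
  hence "card {m. m < N \<and> (\<exists>t>y. t\<^sup>2 dvd X + m)} \<le> card (\<Union>t\<in>{y<..T}. ?B t)"
    by (intro card_mono) auto
  also have "\<dots> \<le> (\<Sum>t\<in>{y<..T}. card (?B t))" by (intro card_UN_le) auto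
  finally have "real (card {m. m < N \<and> (\<exists>t>y. t\<^sup>2 dvd X + m)}) \<le> (\<Sum>t\<in>{y<..T}. real (card (?B t)))"
    by (simp only: of_nat_sum[symmetric] of_nat_le_iff)
  also have "\<dots> \<le> (\<Sum>t\<in>{y<..T}. real N * (1 / (real t)\<^sup>2) + 1)"
    by (intro sum_mono order.trans[OF card_multiples_below_le]) auto
  also have "\<dots> = real N * (\<Sum>t\<in>{y<..T}. 1 / (real t)\<^sup>2) + real (card {y<..T})"
    by (simp add: sum.distrib sum_distrib_left)
  also have "\<dots> \<le> real N * (1 / real y) + real T"
  proof (intro add_mono mult_left_mono)
    show "(\<Sum>t\<in>{y<..T}. 1 / (real t)\<^sup>2) \<le> 1 / real y"
    proof (cases "y \<le> T")
      case True
      have "1 / real T \<ge> 0" by simp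
      thus ?thesis using sum_inverse_squares_le[OF assms(1) True] by linarith
    qed auto
  qed auto
  finally show ?thesis using T by simp
qed

section \<open>Short intervals\<close>

text \<open>Elements without a large square divisor are handled by the divisor sum, the others by
  the divisor bound and their small number. The hypothesis \<open>dens\<close> makes the set dense
  enough for a saving over the full interval of length \<open>g ^ J\<close> to be a saving over the
  set.\<close>

lemma digit_avoiding_d4_sum_le:
  assumes g: "g \<ge> 3" and b: "b < g" and L: "4 * total_digit_weight g \<le> real g powr (1/20)"
    and dens: "real g \<le> real (g - 1) * real g powr (1/250)" and c: "c > 0"
  shows "\<exists>C>0. \<exists>X0. \<forall>X\<ge>X0. \<forall>J. c * real X powr (3/5) \<le> real (g ^ J) \<and> g ^ J \<le> X \<longrightarrow>
    (\<Sum>m\<in>digit_avoiding g b J. real (d4 (X + m))) \<le> C * ln (real X) ^ 7 * real (g - 1) ^ J"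
proof -
  obtain C1 where C1: "C1 > 0" "\<And>n. n > 0 \<Longrightarrow> real (dk 7 n) \<le> C1 * real n powr (1/20)"
    using dk_le_powr[of "1/20" 7] by auto
  obtain C2 where C2: "C2 > 0" "\<And>n. n > 0 \<Longrightarrow> real (dk 4 n) \<le> C2 * real n powr (1/250)"
    using dk_le_powr[of "1/250" 4] by auto
  \<comment> \<open>The constant of \<open>dk_4_le_sum_dk_7\<close> for \<open>r = 200\<close>:
    below, \<open>n \<le> X\<^sup>2 < (y + 1) ^ 200\<close> with \<open>y\<close> the integer part
    of \<open>X powr (1/100)\<close>.\<close>
  define C0 where "C0 = (64 * 4 ^ 200 :: real)"
  have g0: "real g > 0" using g by simp
  \<comment> \<open>The divisor bound times the proportion of exceptional integers in the interval.
    The saving is \<open>1/100 - 1/250 = 3/500\<close>, more than the \<open>1/250\<close> required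
    to compensate for the sparsity of the set.\<close>
  have "\<forall>\<^sub>F x::real in at_top. C2 * (2 * x) powr (1/250) * (2 * x powr (-1/100) + 2 / c * x powr (-1/10)) \<le> x powr (-1/250)"
    using C2(1) c by real_asymp
  moreover have "\<forall>\<^sub>F x::real in at_top. 4 * real g * x powr (21/20) \<le> c powr (9/5) * x powr (27/25)"
    using g0 c by real_asymp
  moreover have "\<forall>\<^sub>F x::real in at_top. 1 + ln (2 * x powr (21/40)) \<le> 2 * ln x" by real_asymp
  moreover have "\<forall>\<^sub>F x::real in at_top. x \<ge> 4" by real_asymp
  moreover have "\<forall>\<^sub>F x::real in at_top. ln x \<ge> 1" by real_asymp
  moreover have "\<forall>\<^sub>F x::real in at_top. x powr (1/100) \<ge> 2" by real_asymp
  ultimately have ev: "\<forall>\<^sub>F x::real in at_top.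
      C2 * (2 * x) powr (1/250) * (2 * x powr (-1/100) + 2 / c * x powr (-1/10)) \<le> x powr (-1/250) \<and>
      4 * real g * x powr (21/20) \<le> c powr (9/5) * x powr (27/25) \<and>
      1 + ln (2 * x powr (21/40)) \<le> 2 * ln x \<and> x \<ge> 4 \<and> ln x \<ge> 1 \<and> x powr (1/100) \<ge> 2"
    (is "\<forall>\<^sub>F x::real in at_top. ?P x")
    by eventually_elim blast
  hence "\<forall>\<^sub>F X::nat in at_top. ?P (real X)"
    by (rule eventually_compose_filterlim) (rule filterlim_real_sequentially)
  then obtain X0 where X0: "\<And>X::nat. X \<ge> X0 \<Longrightarrow> ?P (real X)" by (auto simp: eventually_at_top_linorder)
  define C where "C = C0 * (2 * real g * C1) * 2 ^ 7 + 1"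
  have "(\<Sum>m\<in>digit_avoiding g b J. real (d4 (X + m))) \<le> C * ln (real X) ^ 7 * real (g - 1) ^ J"
    if X: "X \<ge> X0" and J: "c * real X powr (3/5) \<le> real (g ^ J)" "g ^ J \<le> X" for X J
  proof -
    define x where "x = real X"
    note P = X0[OF X, folded x_def]
    have x4: "x \<ge> 4" using P by blast
    hence x0: "x > 0" by simp
    have X4: "X \<ge> 4" using x4 unfolding x_def by simp
    define N where "N = g ^ J"
    have N: "c * x powr (3/5) \<le> real N" "real N \<le> x" "N \<le> X" "N > 0"
      using J g unfolding x_def N_def by auto
    let ?A = "digit_avoiding g b J"
    have A_lt: "m < N" if "m \<in> ?A" for m using that unfolding digit_avoiding_def N_def by simp
    define y where "y = nat \<lfloor>x powr (1/100)\<rfloor>"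
    have y_le: "real y \<le> x powr (1/100)" and y_gt: "x powr (1/100) < real y + 1"
      unfolding y_def by (simp_all add: of_nat_nat)
    have y0: "y > 0" using y_gt P by simp
    have y_ge: "x powr (1/100) / 2 \<le> real y" using y_gt P by simp
    \<comment> \<open>From \<open>D\<^sup>2 \<le> n * y ^ 5\<close> and \<open>n \<le> 2 * x\<close>
      follows \<open>D\<^sup>2 \<le> 2 * x powr (21/20)\<close>, so \<open>Q\<close> bounds all
      divisors that occur.\<close>
    define Q where "Q = nat \<lfloor>2 * x powr (21/40)\<rfloor>"
    have Q_le: "real Q \<le> 2 * x powr (21/40)" unfolding Q_def by (simp add: of_nat_nat)
    have Q1: "Q \<ge> 1"
    proof -
      have "1 \<le> x powr (21/40)" using x4 by (intro ge_one_powr_ge_zero) auto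
      hence "1 \<le> 2 * x powr (21/40)" by linarith
      thus ?thesis unfolding Q_def by linarith
    qed
    have Q_ok: "real g * (real Q)\<^sup>2 \<le> real (g ^ J) powr (9/5)"
    proof -
      have "real g * (real Q)\<^sup>2 \<le> real g * (2 * x powr (21/40))\<^sup>2"
        using Q_le by (intro mult_left_mono power_mono) auto
      also have "\<dots> = 4 * real g * x powr (21/20)"
        using x0 by (simp add: power_mult_distrib powr_powr flip: powr_realpow)
      also have "\<dots> \<le> c powr (9/5) * x powr (27/25)" using P by blast
      also have "\<dots> = (c * x powr (3/5)) powr (9/5)" using c x0 by (simp add: powr_mult powr_powr)
      also have "\<dots> \<le> real N powr (9/5)" using N c by (intro powr_mono2) auto
      finally show ?thesis unfolding N_def .
    qed
    define E where "E = {m. m < N \<and> (\<exists>t>y. t\<^sup>2 dvd X + m)}"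
    have finE: "finite E" unfolding E_def by auto
    have good: "real (d4 (X + m)) \<le> C0 * (\<Sum>D | D \<in> {1..Q} \<and> D dvd X + m. real (dk 7 D))"
      if m: "m \<in> ?A" "m \<notin> E" for m
    proof -
      have n_le: "real (X + m) \<le> 2 * x" using A_lt[OF m(1)] N unfolding x_def by simp
      have "real (X + m) \<le> x * x" using n_le x4 mult_right_mono[of 4 x x] by linarith
      also have "\<dots> = (x powr (1/100)) ^ 200" using x0 by (simp add: powr_powr power2_eq_square flip: powr_realpow)
      also have "\<dots> < (real y + 1) ^ 200" using y_gt by (intro power_strict_mono) auto
      finally have few: "X + m < (y + 1) ^ 200"
        by (metis of_nat_1 of_nat_add of_nat_less_iff of_nat_power)
      have "dk 4 (X + m) \<le> 64 * 4 ^ 200 * (\<Sum>D | D dvd X + m \<and> D\<^sup>2 \<le> (X + m) * y ^ 5. dk 7 D)"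
      proof (rule dk_4_le_sum_dk_7[OF _ y0 _ few])
        fix t assume "t\<^sup>2 dvd X + m"
        moreover have "\<not> (\<exists>t>y. t\<^sup>2 dvd X + m)" using m(2) A_lt[OF m(1)] unfolding E_def by simp
        ultimately show "t \<le> y" by (meson not_le)
      qed (use X4 in simp)
      also have "(\<Sum>D | D dvd X + m \<and> D\<^sup>2 \<le> (X + m) * y ^ 5. dk 7 D) \<le> (\<Sum>D | D \<in> {1..Q} \<and> D dvd X + m. dk 7 D)"
      proof (rule sum_mono2)
        show "{D. D dvd X + m \<and> D\<^sup>2 \<le> (X + m) * y ^ 5} \<subseteq> {D. D \<in> {1..Q} \<and> D dvd X + m}"
        proof (rule subsetI)
          fix D assume "D \<in> {D. D dvd X + m \<and> D\<^sup>2 \<le> (X + m) * y ^ 5}"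
          hence D: "D dvd X + m" "D\<^sup>2 \<le> (X + m) * y ^ 5" by auto
          have "(real D)\<^sup>2 \<le> real (X + m) * real y ^ 5"
            using D(2) by (metis of_nat_le_iff of_nat_mult of_nat_power)
          also have "\<dots> \<le> (2 * x) * (x powr (1/100)) ^ 5"
            using n_le y_le x0 by (intro mult_mono power_mono) auto
          also have "\<dots> = 2 * (x powr 1 * x powr (1/20))"
            using x0 by (simp add: powr_powr flip: powr_realpow)
          also have "\<dots> = 2 * x powr (21/20)" using x0 by (simp only: powr_add[symmetric]) simp
          also have "\<dots> \<le> 4 * x powr (21/20)" by simp
          also have "\<dots> = (2 * x powr (21/40))\<^sup>2"
            using x0 by (simp add: power_mult_distrib powr_powr flip: powr_realpow)
          finally have "real D \<le> 2 * x powr (21/40)" by (rule power2_le_imp_le) simp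
          hence "D \<le> Q" unfolding Q_def by (simp add: le_nat_floor)
          moreover have "D > 0" using D(1) X4 by (cases "D = 0") auto
          ultimately show "D \<in> {D. D \<in> {1..Q} \<and> D dvd X + m}" using D by simp
        qed
      qed auto
      finally have "dk 4 (X + m) \<le> 64 * 4 ^ 200 * (\<Sum>D | D \<in> {1..Q} \<and> D dvd X + m. dk 7 D)" by simp
      hence "real (dk 4 (X + m)) \<le> real (64 * 4 ^ 200 * (\<Sum>D | D \<in> {1..Q} \<and> D dvd X + m. dk 7 D))"
        by (simp only: of_nat_le_iff)
      also have "\<dots> = C0 * (\<Sum>D | D \<in> {1..Q} \<and> D dvd X + m. real (dk 7 D))" unfolding C0_def by simp
      finally show ?thesis using d4_le_dk[of "X + m"] X4 by simp
    qed
    have bad: "real (d4 (X + m)) \<le> C2 * (2 * x) powr (1/250)" if m: "m \<in> E" for m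
    proof -
      have "real (d4 (X + m)) \<le> real (dk 4 (X + m))" using d4_le_dk[of "X + m"] X4 by simp
      also have "\<dots> \<le> C2 * real (X + m) powr (1/250)" using X4 by (intro C2) auto
      also have "\<dots> \<le> C2 * (2 * x) powr (1/250)"
        using C2(1) m N unfolding E_def x_def by (intro mult_left_mono powr_mono2) auto
      finally show ?thesis .
    qed
    have "(\<Sum>m\<in>?A. real (d4 (X + m))) \<le> (\<Sum>m\<in>?A.
       C0 * (\<Sum>D | D \<in> {1..Q} \<and> D dvd X + m. real (dk 7 D)) + (if m \<in> E then C2 * (2 * x) powr (1/250) else 0))"
    proof (rule sum_mono)
      fix m assume m: "m \<in> ?A"
      have "0 \<le> C0 * (\<Sum>D | D \<in> {1..Q} \<and> D dvd X + m. real (dk 7 D))"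
        unfolding C0_def by (intro mult_nonneg_nonneg sum_nonneg) auto
      thus "real (d4 (X + m)) \<le> C0 * (\<Sum>D | D \<in> {1..Q} \<and> D dvd X + m. real (dk 7 D)) +
          (if m \<in> E then C2 * (2 * x) powr (1/250) else 0)"
        using good[OF m] bad[of m] by (cases "m \<in> E") auto
    qed
    also have "\<dots> = C0 * (\<Sum>m\<in>?A. \<Sum>D | D \<in> {1..Q} \<and> D dvd X + m. real (dk 7 D)) +
       (\<Sum>m\<in>?A. if m \<in> E then C2 * (2 * x) powr (1/250) else 0)"
      by (simp only: sum.distrib sum_distrib_left)
    also have "\<dots> \<le> C0 * (2 * real g * C1) * 2 ^ 7 * ln x ^ 7 * real (g - 1) ^ J + ln x ^ 7 * real (g - 1) ^ J"
    proof (rule add_mono)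
      have "(\<Sum>m\<in>?A. \<Sum>D | D \<in> {1..Q} \<and> D dvd X + m. real (dk 7 D))
          \<le> 2 * real g * C1 * (1 + ln (real Q)) ^ 7 * real (g - 1) ^ J"
        by (rule sum_dk_divisors_le[OF g b L Q_ok Q1 C1(2,1)])
      also have "\<dots> \<le> 2 * real g * C1 * (2 * ln x) ^ 7 * real (g - 1) ^ J"
      proof (intro mult_right_mono mult_left_mono power_mono)
        have "ln (real Q) \<le> ln (2 * x powr (21/40))" using Q_le Q1 by (intro ln_mono) auto
        thus "1 + ln (real Q) \<le> 2 * ln x" using P by linarith
      qed (use C1 Q1 in auto)
      finally have "C0 * (\<Sum>m\<in>?A. \<Sum>D | D \<in> {1..Q} \<and> D dvd X + m. real (dk 7 D))
          \<le> C0 * (2 * real g * C1 * (2 * ln x) ^ 7 * real (g - 1) ^ J)"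
        by (rule mult_left_mono) (simp add: C0_def)
      also have "\<dots> = C0 * (2 * real g * C1) * 2 ^ 7 * ln x ^ 7 * real (g - 1) ^ J"
        by (simp only: power_mult_distrib mult_ac)
      finally show "C0 * (\<Sum>m\<in>?A. \<Sum>D | D \<in> {1..Q} \<and> D dvd X + m. real (dk 7 D)) \<le> \<dots>" .
    next
      have "(\<Sum>m\<in>?A. if m \<in> E then C2 * (2 * x) powr (1/250) else 0) = real (card (?A \<inter> E)) * (C2 * (2 * x) powr (1/250))"
        by (simp add: sum.If_cases)
      also have "\<dots> \<le> real (card E) * (C2 * (2 * x) powr (1/250))"
        using finE C2 by (intro mult_right_mono) (auto intro: card_mono)
      also have "\<dots> \<le> (real N / real y + sqrt (2 * x)) * (C2 * (2 * x) powr (1/250))"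
        unfolding E_def x_def using y0 N C2 by (intro mult_right_mono card_large_square_divisor_le) auto
      also have "\<dots> \<le> (real N * (2 * x powr (-1/100) + 2 / c * x powr (-1/10))) * (C2 * (2 * x) powr (1/250))"
      proof (intro mult_right_mono)
        have "1 / real y \<le> 1 / (x powr (1/100) / 2)"
          using y_ge x0 y0 by (intro divide_left_mono mult_pos_pos) auto
        also have "\<dots> = 2 * x powr (-1/100)" by (simp add: powr_minus_divide)
        finally have "real N * (1 / real y) \<le> real N * (2 * x powr (-1/100))" by (intro mult_left_mono) auto
        moreover have "sqrt (2 * x) \<le> real N * (2 / c * x powr (-1/10))"
        proof -
          have "sqrt (2 * x) \<le> sqrt (4 * x)" using x0 by simp
          also have "\<dots> = 2 * x powr (1/2)" using x0 by (simp add: real_sqrt_mult powr_half_sqrt)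
          \<comment> \<open>The lower bound \<open>c * x powr (3/5)\<close> for \<open>N\<close>
            beats the square root by \<open>x powr (1/10)\<close>.\<close>
          also have "x powr (1/2) = x powr (3/5) * x powr (-1/10)" by (simp add: powr_add[symmetric])
          also have "2 * (x powr (3/5) * x powr (-1/10)) = c * x powr (3/5) * (2 / c * x powr (-1/10))"
            using c by simp
          also have "\<dots> \<le> real N * (2 / c * x powr (-1/10))"
            using N c by (intro mult_right_mono) auto
          finally show ?thesis .
        qed
        ultimately show "real N / real y + sqrt (2 * x) \<le> real N * (2 * x powr (-1/100) + 2 / c * x powr (-1/10))"
          by (simp add: distrib_left)
      qed (use C2 in auto)
      also have "\<dots> = real N * (C2 * (2 * x) powr (1/250) * (2 * x powr (-1/100) + 2 / c * x powr (-1/10)))"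
        by (simp only: mult_ac)
      also have "\<dots> \<le> real N * x powr (-1/250)" using P by (intro mult_left_mono) auto
      also have "\<dots> \<le> real (g - 1) ^ J"
      proof -
        have "real N = real g ^ J" unfolding N_def by simp
        \<comment> \<open>The ratio of \<open>g ^ J\<close> to \<open>(g - 1) ^ J\<close> is at most
          \<open>N powr (1/250)\<close>, which the saved power of \<open>x\<close> cancels.\<close>
        also have "\<dots> \<le> (real (g - 1) * real g powr (1/250)) ^ J" using dens by (intro power_mono) auto
        also have "\<dots> = real (g - 1) ^ J * real N powr (1/250)"
          unfolding N_def using g0 by (simp add: power_mult_distrib powr_powr mult.commute flip: powr_realpow)
        also have "\<dots> \<le> real (g - 1) ^ J * x powr (1/250)" using N by (intro mult_left_mono powr_mono2) auto
        finally have "real N * x powr (-1/250) \<le> real (g - 1) ^ J * x powr (1/250) * x powr (-1/250)"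
          by (intro mult_right_mono) auto
        also have "\<dots> = real (g - 1) ^ J" using x0 by (simp add: mult.assoc powr_add[symmetric])
        finally show ?thesis .
      qed
      also have "\<dots> \<le> ln x ^ 7 * real (g - 1) ^ J"
        using P mult_right_mono[of 1 "ln x ^ 7" "real (g - 1) ^ J"] by simp
      finally show "(\<Sum>m\<in>?A. if m \<in> E then C2 * (2 * x) powr (1/250) else 0) \<le> ln x ^ 7 * real (g - 1) ^ J" .
    qed
    also have "\<dots> = C * ln x ^ 7 * real (g - 1) ^ J" unfolding C_def by (simp only: distrib_right mult_1)
    finally show ?thesis unfolding x_def .
  qed
  moreover have "C > 0" unfolding C_def C0_def using C1(1) g by (intro add_nonneg_pos mult_nonneg_nonneg) auto
  ultimately show ?thesis by blast
qed

section \<open>Comparison of the interval with digit-avoiding integers\<close>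

lemma base_digit_power_add:
  fixes g m :: nat
  assumes "m < g ^ k" "i < k" "g > 0"
  shows "(g ^ k + m) div g ^ i mod g = m div g ^ i mod g"
proof -
  have "k = i + Suc (k - i - 1)" using assms by simp
  hence "g ^ k = g ^ (i + Suc (k - i - 1))" by (rule arg_cong)
  also have "\<dots> = g ^ i * (g * g ^ (k - i - 1))" by (simp only: power_add power_Suc)
  finally have pow: "g ^ k = g ^ i * (g * g ^ (k - i - 1))" .
  have "(g ^ k + m) div g ^ i = g * g ^ (k - i - 1) + m div g ^ i"
    unfolding pow using assms by (intro div_mult_self4) auto
  thus ?thesis by simp
qed

text \<open>As \<open>n\<close> exceeds \<open>g ^ k\<close>, every position below \<open>J\<close>
  occurs in the expansion of \<open>n\<close>, so the leading zeros of \<open>m\<close> are digits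
  of \<open>n\<close> as well.\<close>

lemma missing_digit_interval_subset:
  assumes "g \<ge> 2" "J \<le> k" "H < real (g ^ J)"
  shows "missing_digit_interval g b (real (g ^ k)) H \<subseteq> (\<lambda>m. g ^ k + m) ` digit_avoiding g b J"
proof
  fix n assume n: "n \<in> missing_digit_interval g b (real (g ^ k)) H"
  define m where "m = n - g ^ k"
  have gt: "g ^ k < n" using n unfolding missing_digit_interval_def mem_Collect_eq of_nat_less_iff by blast
  hence nm: "n = g ^ k + m" unfolding m_def by simp
  have "real n < real (g ^ k) + real (g ^ J)" using n assms by (auto simp: missing_digit_interval_def)
  hence "n < g ^ k + g ^ J" by (simp only: of_nat_add[symmetric] of_nat_less_iff)
  hence m_lt: "m < g ^ J" using nm by simp
  have gJk: "g ^ J \<le> g ^ k" using assms by (intro power_increasing) auto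
  have "m div g ^ i mod g \<noteq> b" if "i < J" for i
  proof -
    have "g ^ i \<le> g ^ k" using assms that by (intro power_increasing) auto
    hence "n div g ^ i mod g \<in> base_digits g n" using gt unfolding base_digits_def by auto
    hence "n div g ^ i mod g \<noteq> b" using n by (auto simp: missing_digit_interval_def)
    thus ?thesis unfolding nm using base_digit_power_add[OF less_le_trans[OF m_lt gJk], of i] assms that by simp
  qed
  hence "m \<in> digit_avoiding g b J" using m_lt unfolding digit_avoiding_def by blast
  thus "n \<in> (\<lambda>m. g ^ k + m) ` digit_avoiding g b J" using nm by blast
qed

text \<open>The digits of \<open>g ^ k + m\<close> are those of \<open>m\<close>, padding zeros and
  a leading 1; as \<open>b \<ge> 2\<close>, the last two kinds are harmless. The value
  \<open>m = 0\<close> is removed because the left endpoint is excluded.\<close>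

lemma missing_digit_interval_supset:
  assumes "b \<in> {2..<g}" "J \<le> k" "real (g ^ J) \<le> H"
  shows "(\<lambda>m. g ^ k + m) ` (digit_avoiding g b J - {0}) \<subseteq> missing_digit_interval g b (real (g ^ k)) H"
proof (rule image_subsetI)
  fix m assume "m \<in> digit_avoiding g b J - {0}"
  hence m: "m \<in> digit_avoiding g b J" "m \<noteq> 0" by auto
  have m_lt: "m < g ^ J" using m by (auto simp: digit_avoiding_def)
  have g: "g > 2" using assms by auto
  have gJk: "g ^ J \<le> g ^ k" using assms by (intro power_increasing) auto
  have "d \<in> {0..<g} - {b}" if "d \<in> base_digits g (g ^ k + m)" for d
  proof -
    from that obtain i where i: "d = (g ^ k + m) div g ^ i mod g" "g ^ i \<le> g ^ k + m"
      unfolding base_digits_def by auto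
    \<comment> \<open>There is no carry past the leading 1:
      \<open>g ^ k + m < 2 * g ^ k \<le> g ^ (k + 1)\<close>.\<close>
    have "i \<le> k"
    proof (rule ccontr)
      assume "\<not> i \<le> k"
      hence "g ^ Suc k \<le> g ^ i" using g by (intro power_increasing) auto
      moreover have "2 * g ^ k \<le> g * g ^ k" using g by (intro mult_right_mono) auto
      ultimately show False using i(2) m_lt gJk by simp
    qed
    have "d \<noteq> b"
    proof (cases "i < k")
      case True
      have d: "d = m div g ^ i mod g"
        unfolding i(1) using True g by (intro base_digit_power_add less_le_trans[OF m_lt gJk]) auto
      show ?thesis
      proof (cases "i < J")
        case True
        thus ?thesis using d m by (auto simp: digit_avoiding_def)
      next
        case False
        hence "g ^ J \<le> g ^ i" using g by (intro power_increasing) auto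
        hence "m div g ^ i = 0" using m_lt by simp
        thus ?thesis using d assms by simp
      qed
    next
      case False
      hence "i = k" using \<open>i \<le> k\<close> by simp
      hence "d = 1" using i(1) m_lt gJk g by simp
      thus ?thesis using assms by auto
    qed
    thus ?thesis using i(1) g by simp
  qed
  moreover have "real (g ^ k + m) \<le> real (g ^ k) + H" using m_lt assms(3) by (simp del: of_nat_power)
  ultimately show "g ^ k + m \<in> missing_digit_interval g b (real (g ^ k)) H"
    using m(2) by (auto simp: missing_digit_interval_def simp del: of_nat_power)
qed

theorem theorem1p1:
  "\<exists>\<epsilon>0::real > 0. \<forall>\<epsilon>. 0 < \<epsilon> \<and> \<epsilon> \<le> \<epsilon>0 \<longrightarrow>
    (\<exists>g0::nat. \<forall>g\<ge>g0. \<forall>b\<in>{2..<g}.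
      \<forall>c1 > 0. \<forall>c2 > 0. \<exists>C > 0. \<exists>X0.
        \<forall>X::nat. (\<exists>k. X = g ^ k) \<and> X \<ge> X0 \<longrightarrow>
          (\<forall>H::real. c1 * real X powr (3 / 5 + \<epsilon>) \<le> H \<and> H \<le> c2 * real X powr (1 - \<epsilon>) \<longrightarrow>
            (\<Sum>n\<in>missing_digit_interval g b (real X) H. real (d4 n))
              \<le> C * ln (real X) ^ 7 * real (card (missing_digit_interval g b (real X) H))))"
proof -
  \<comment> \<open>The two requirements on \<open>g\<close>: the logarithmic bound for the total
    digit weight must lie below a small power of \<open>g\<close>, and \<open>(g - 1) ^ J\<close>
    must be close to \<open>g ^ J\<close>.\<close>
  have "\<forall>\<^sub>F x::real in at_top. 4 * (7 + 4 * ln x) \<le> x powr (1/20) \<and> x \<le> (x - 1) * x powr (1/250) \<and> x \<ge> 3"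
    by (intro eventually_conj; real_asymp)
  hence "\<forall>\<^sub>F g::nat in at_top. 4 * (7 + 4 * ln (real g)) \<le> real g powr (1/20)
      \<and> real g \<le> (real g - 1) * real g powr (1/250) \<and> real g \<ge> 3"
    by (rule eventually_compose_filterlim) (rule filterlim_real_sequentially)
  then obtain g0 where g0: "\<And>g. g \<ge> g0 \<Longrightarrow> 4 * (7 + 4 * ln (real g)) \<le> real g powr (1/20)
      \<and> real g \<le> (real g - 1) * real g powr (1/250) \<and> real g \<ge> 3"
    by (auto simp: eventually_at_top_linorder)
  have main: "\<exists>C > 0. \<exists>X0. \<forall>X::nat. (\<exists>k. X = g ^ k) \<and> X \<ge> X0 \<longrightarrow>
          (\<forall>H::real. c1 * real X powr (3 / 5 + \<epsilon>) \<le> H \<and> H \<le> c2 * real X powr (1 - \<epsilon>) \<longrightarrow>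
            (\<Sum>n\<in>missing_digit_interval g b (real X) H. real (d4 n))
              \<le> C * ln (real X) ^ 7 * real (card (missing_digit_interval g b (real X) H)))"
    if \<epsilon>: "0 < \<epsilon>" and gg: "g \<ge> g0" and b: "b \<in> {2..<g}" and c: "c1 > 0" "c2 > 0" for \<epsilon> g b c1 c2
  proof -
    have g3: "g \<ge> 3" using g0[OF gg] by simp
    have gr: "real g > 0" using g3 by simp
    have L: "4 * total_digit_weight g \<le> real g powr (1/20)"
      using order.trans[OF mult_left_mono[OF sum_digit_weight_le[OF g3], of 4] g0[OF gg, THEN conjunct1]] by simp
    have dens: "real g \<le> real (g - 1) * real g powr (1/250)" using g0[OF gg] g3 by (simp add: of_nat_diff)
    have bg: "b < g" using b by simp
    obtain C X1 where C: "C > 0" "\<And>X J. X \<ge> X1 \<Longrightarrow> c1 * real X powr (3/5) \<le> real (g ^ J) \<Longrightarrow> g ^ J \<le> X \<Longrightarrow>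
        (\<Sum>m\<in>digit_avoiding g b J. real (d4 (X + m))) \<le> C * ln (real X) ^ 7 * real (g - 1) ^ J"
      using digit_avoiding_d4_sum_le[OF g3 bg L dens c(1)] by blast
    \<comment> \<open>The first inequality yields \<open>g * H \<le> X\<close>, hence
      \<open>g ^ J \<le> X\<close> for the \<open>J\<close> chosen below; the second yields
      \<open>H \<ge> g\<close>, hence \<open>J \<ge> 2\<close>.\<close>
    have "\<forall>\<^sub>F x::real in at_top. real g * c2 * x powr (1 - \<epsilon>) \<le> x" using gr c \<epsilon> by real_asymp
    moreover have "\<forall>\<^sub>F x::real in at_top. real g \<le> c1 * x powr (3/5)" using gr c \<epsilon> by real_asymp
    moreover have "\<forall>\<^sub>F x::real in at_top. x \<ge> 1" by real_asymp
    ultimately have "\<forall>\<^sub>F x::real in at_top. real g * c2 * x powr (1 - \<epsilon>) \<le> x \<and> real g \<le> c1 * x powr (3/5) \<and> x \<ge> 1"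
      by eventually_elim blast
    hence "\<forall>\<^sub>F X::nat in at_top. real g * c2 * real X powr (1 - \<epsilon>) \<le> real X \<and> real g \<le> c1 * real X powr (3/5) \<and> real X \<ge> 1"
      by (rule eventually_compose_filterlim) (rule filterlim_real_sequentially)
    then obtain X2 where X2: "\<And>X::nat. X \<ge> X2 \<Longrightarrow>
        real g * c2 * real X powr (1 - \<epsilon>) \<le> real X \<and> real g \<le> c1 * real X powr (3/5) \<and> real X \<ge> 1"
      by (auto simp: eventually_at_top_linorder)
    have "(\<Sum>n\<in>missing_digit_interval g b (real X) H. real (d4 n))
        \<le> (2 * real g * C) * ln (real X) ^ 7 * real (card (missing_digit_interval g b (real X) H))"
      if Xk: "X = g ^ k" and X: "X \<ge> max X1 X2"
        and H: "c1 * real X powr (3 / 5 + \<epsilon>) \<le> H" "H \<le> c2 * real X powr (1 - \<epsilon>)" for X k H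
    proof -
      let ?M = "missing_digit_interval g b (real X) H"
      have P: "real g * c2 * real X powr (1 - \<epsilon>) \<le> real X" "real g \<le> c1 * real X powr (3/5)" "real X \<ge> 1"
        using X2[of X] X by auto
      have "real X powr (3/5) \<le> real X powr (3/5 + \<epsilon>)" using P \<epsilon> by (intro powr_mono) auto
      hence H35: "c1 * real X powr (3/5) \<le> H" using H c by (meson mult_left_mono less_imp_le order.trans)
      have gH: "real g * H \<le> real X"
        using P(1) mult_left_mono[OF H(2), of "real g"] by (simp add: mult.assoc)
      \<comment> \<open>Minimality gives \<open>g ^ (J - 1) \<le> H < g ^ J\<close>: the interval
        set is caught between digit strings of lengths \<open>J - 1\<close> and
        \<open>J\<close>.\<close>
      define J where "J = (LEAST J. H < real (g ^ J))"
      have ex: "\<exists>J. H < real (g ^ J)"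
        using real_arch_pow[of "real g" H] g3 by auto
      have J: "H < real (g ^ J)" unfolding J_def using ex by (rule LeastI_ex)
      have J2: "J \<ge> 2"
      proof (rule ccontr)
        assume "\<not> J \<ge> 2"
        hence "g ^ J \<le> g ^ 1" using g3 by (intro power_increasing) auto
        hence "real (g ^ J) \<le> real g" by simp
        thus False using J P(2) H35 by linarith
      qed
      define I where "I = J - 1"
      have JI: "J = Suc I" "I \<ge> 1" using J2 unfolding I_def by auto
      have I: "real (g ^ I) \<le> H"
        using not_less_Least[of I "\<lambda>J. H < real (g ^ J)"] JI unfolding J_def[symmetric] by simp
      have "real (g ^ J) \<le> real X" unfolding JI using mult_left_mono[OF I, of "real g"] gH by simp
      hence gJX: "g ^ J \<le> X" by (simp only: of_nat_le_iff)
      hence Jk: "J \<le> k" unfolding Xk using g3 by (simp add: power_increasing_iff)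
      have finM: "finite ?M"
        using missing_digit_interval_subset[of g J k H b] g3 Jk J unfolding Xk by (auto intro: finite_subset)
      have card_le: "real (g - 1) ^ J \<le> 2 * real g * real (card ?M)"
      proof -
        have "card ((\<lambda>m. X + m) ` (digit_avoiding g b I - {0})) \<le> card ?M"
          using finM missing_digit_interval_supset[of b g I k H] b Jk JI I unfolding Xk by (intro card_mono) auto
        moreover have "card ((\<lambda>m. X + m) ` (digit_avoiding g b I - {0})) = card (digit_avoiding g b I - {0})"
          by (intro card_image) auto
        moreover have "card (digit_avoiding g b I - {0}) \<ge> (g - 1) ^ I - 1"
          using card_Diff1_le[of "digit_avoiding g b I" 0] diff_card_le_card_Diff[of "{0}" "digit_avoiding g b I"]
            card_digit_avoiding[OF bg, of I] by simp
        ultimately have card: "(g - 1) ^ I \<le> card ?M + 1" by linarith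
        \<comment> \<open>Since \<open>(g - 1) ^ I \<ge> 2\<close>, the element lost at
          \<open>m = 0\<close> costs only a factor 2; passing from \<open>I\<close> to
          \<open>J\<close> costs a factor below \<open>g\<close>.\<close>
        have "(2::nat) ^ 1 \<le> 2 ^ I" using JI by (intro power_increasing) auto
        also have "\<dots> \<le> (g - 1) ^ I" using g3 by (intro power_mono) auto
        finally have "(g - 1) ^ I \<le> 2 * card ?M" using card by simp
        hence "(g - 1) * (g - 1) ^ I \<le> g * (2 * card ?M)" by (intro mult_mono) auto
        hence "(g - 1) ^ J \<le> 2 * g * card ?M" unfolding JI by (simp add: mult_ac)
        thus ?thesis by (metis of_nat_le_iff of_nat_mult of_nat_numeral of_nat_power)
      qed
      have "(\<Sum>n\<in>?M. real (d4 n)) \<le> (\<Sum>n\<in>(\<lambda>m. X + m) ` digit_avoiding g b J. real (d4 n))"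
        using missing_digit_interval_subset[of g J k H b] g3 Jk J unfolding Xk by (intro sum_mono2) auto
      also have "\<dots> = (\<Sum>m\<in>digit_avoiding g b J. real (d4 (X + m)))"
        by (subst sum.reindex) auto
      also have "\<dots> \<le> C * ln (real X) ^ 7 * real (g - 1) ^ J"
        using H35 J X by (intro C gJX) auto
      also have "\<dots> \<le> C * ln (real X) ^ 7 * (2 * real g * real (card ?M))"
        using C(1) P(3) by (intro mult_left_mono card_le) auto
      finally show ?thesis by (simp only: mult_ac)
    qed
    moreover have "2 * real g * C > 0" using C gr by simp
    ultimately show ?thesis by blast
  qed
  show ?thesis
    \<comment> \<open>\<open>main\<close> is proved for every positive \<open>\<epsilon>\<close>, so
      1 can serve as \<open>\<epsilon>0\<close>.\<close>
    by (intro exI[of _ 1] conjI allI impI exI[of _ g0] ballI main) auto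
qed

end
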